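(* Let $k\in\{3,4\}$ and let $n\geq 2k+1$ be an integer. Then the toughness of the Kneser graph $K(n,k)$ equals $$t(K(n,k))=\frac{n}{k}-1.$$ Moreover, any subset of vertices $S$ satisfying $t(K(n,k))=\frac{|S|}{c(K(n,k)\setminus S)}$ must be the complement of a maximum independent set in $K(n,k)$.
   Context: For integers $n\geq 2k+1$, $k\ge 1$, the Kneser graph $K(n,k)$ has as vertices the $k$-element subsets of $[n]=\{1,\dots,n\}$, two vertices $A,B$ being adjacent iff $A\cap B=\emptyset$. For a connected graph $G$, a vertex cut is a set $S$ of vertices whose removal disconnects $G$; $c(G\setminus S)$ denotes the number of connected components of the graph obtained by deleting $S$. The toughness of $G$ is $t(G)=\min_S \frac{|S|}{c(G\setminus S)}$, the minimum over all vertex cuts $S$ of $G$.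
   Formalization: In the second claim S is required to be a vertex cut; for arbitrary subsets it fails, e.g. k=3, n=9 and S any two vertices, where c(K(9,3)\S)=1 and |S|/c=2=n/k-1. *)

theory Defs
  imports Complex_Main
begin

text \<open>Simple graphs given by a vertex set V and a symmetric adjacency predicate E.\<close>

definition conn_rel :: "'a set \<Rightarrow> ('a \<Rightarrow> 'a \<Rightarrow> bool) \<Rightarrow> ('a \<times> 'a) set" where
  "conn_rel V E = {(x, y). x \<in> V \<and> y \<in> V \<and> (\<lambda>a b. a \<in> V \<and> b \<in> V \<and> E a b)\<^sup>*\<^sup>* x y}"

definition num_components :: "'a set \<Rightarrow> ('a \<Rightarrow> 'a \<Rightarrow> bool) \<Rightarrow> nat" where
  "num_components V E = card (V // conn_rel V E)"

definition is_vertex_cut :: "'a set \<Rightarrow> ('a \<Rightarrow> 'a \<Rightarrow> bool) \<Rightarrow> 'a set \<Rightarrow> bool" where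
  "is_vertex_cut V E S \<longleftrightarrow> S \<subseteq> V \<and> num_components (V - S) E \<ge> 2"

definition toughness :: "'a set \<Rightarrow> ('a \<Rightarrow> 'a \<Rightarrow> bool) \<Rightarrow> real" where
  "toughness V E = Min {real (card S) / real (num_components (V - S) E) | S. is_vertex_cut V E S}"

definition independent_set :: "'a set \<Rightarrow> ('a \<Rightarrow> 'a \<Rightarrow> bool) \<Rightarrow> 'a set \<Rightarrow> bool" where
  "independent_set V E I \<longleftrightarrow> I \<subseteq> V \<and> (\<forall>x\<in>I. \<forall>y\<in>I. \<not> E x y)"

definition maximum_independent_set :: "'a set \<Rightarrow> ('a \<Rightarrow> 'a \<Rightarrow> bool) \<Rightarrow> 'a set \<Rightarrow> bool" where
  "maximum_independent_set V E I \<longleftrightarrow> independent_set V E I \<and>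
     (\<forall>J. independent_set V E J \<longrightarrow> card J \<le> card I)"

definition kneser_verts :: "nat \<Rightarrow> nat \<Rightarrow> nat set set" where
  "kneser_verts n k = {A. A \<subseteq> {1..n} \<and> card A = k}"

definition kneser_adj :: "nat set \<Rightarrow> nat set \<Rightarrow> bool" where
  "kneser_adj A B \<longleftrightarrow> A \<inter> B = {}"

end

theory Submission
  imports Defs "HOL-Library.Ramsey"
begin

text \<open>
  Let \<open>N\<close>, \<open>d\<close>, \<open>-\<tau>\<close>, \<open>\<theta>\<close> be the number of vertices, the degree, the least and the second largest
  eigenvalue of the Kneser graph, and \<open>r = d / \<tau> = n / k - 1\<close>. Let the components left by a cut \<open>S\<close>
  have \<open>m\<^sub>i\<close> vertices and \<open>e\<^sub>i / 2\<close> edges. The inequality behind Hoffman's ratio bound, applied to a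
  function that is constant on each component, gives
  \<open>\<Sum>\<^sub>i (d + \<tau>) m\<^sub>i\<^sup>2 / (e\<^sub>i + \<tau> m\<^sub>i) \<le> N\<close>. A summand is \<open>1 + r\<close> for an isolated vertex and exceeds
  \<open>m\<^sub>i + r\<close> if \<open>e\<^sub>i (m\<^sub>i + r) < d m\<^sub>i (m\<^sub>i - 1)\<close>. The latter holds for all components with at least
  two vertices: trivially while \<open>m\<^sub>i + r < d\<close>, and by
  \<open>e\<^sub>i \<le> \<theta> m\<^sub>i + (d - \<theta>) m\<^sub>i\<^sup>2 / N\<close> up to \<open>m\<^sub>i = N - d - 1\<close>. So \<open>r c \<le> |S|\<close> for the number
  \<open>c\<close> of components, and equality leaves only isolated vertices, which then attain the ratio bound.
  The argument works for all \<open>k \<ge> 2\<close> except for the Petersen graph \<open>K(5, 2)\<close>.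
\<close>

section \<open>Quadratic forms on the k-subsets of a finite set\<close>

definition adjacent_pairs :: "'a set \<Rightarrow> ('a \<Rightarrow> 'a \<Rightarrow> bool) \<Rightarrow> ('a \<times> 'a) set" where
  "adjacent_pairs V E = {(u, v) \<in> V \<times> V. E u v}"

definition adjacency_form :: "'a set \<Rightarrow> ('a \<Rightarrow> 'a \<Rightarrow> bool) \<Rightarrow> ('a \<Rightarrow> real) \<Rightarrow> real" where
  "adjacency_form V E f = (\<Sum>(u, v)\<in>adjacent_pairs V E. f u * f v)"

definition superset_sum :: "'a set \<Rightarrow> nat \<Rightarrow> ('a set \<Rightarrow> real) \<Rightarrow> 'a set \<Rightarrow> real" where
  "superset_sum V k f R = (\<Sum>A | A \<in> nsets V k \<and> R \<subseteq> A. f A)"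

definition inclusion_energy :: "'a set \<Rightarrow> nat \<Rightarrow> ('a set \<Rightarrow> real) \<Rightarrow> nat \<Rightarrow> real" where
  "inclusion_energy V k f i = (\<Sum>R\<in>nsets V i. (superset_sum V k f R)\<^sup>2)"

lemma finite_adjacent_pairs: "finite V \<Longrightarrow> finite (adjacent_pairs V E)"
  unfolding adjacent_pairs_def by (rule finite_subset[of _ "V \<times> V"]) auto

lemma superset_sum_eq_0: "card R > k \<Longrightarrow> superset_sum V k f R = 0"
  unfolding superset_sum_def nsets_def by (intro sum.neutral) (auto dest: card_mono)

lemma superset_sum_self:
  assumes "R \<in> nsets V k"
  shows "superset_sum V k f R = f R"
proof -
  have "{A. A \<in> nsets V k \<and> R \<subseteq> A} = {R}"
    using assms by (auto simp: nsets_def dest: card_subset_eq)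
  then show ?thesis by (simp add: superset_sum_def)
qed

lemma inclusion_energy_0: "inclusion_energy V k f 0 = (\<Sum>A\<in>nsets V k. f A)\<^sup>2"
  by (simp add: inclusion_energy_def superset_sum_def)

lemma inclusion_energy_top: "inclusion_energy V k f k = (\<Sum>A\<in>nsets V k. (f A)\<^sup>2)"
  by (simp add: inclusion_energy_def superset_sum_self)

lemma sum_Pow_eq_sum_nsets:
  fixes g :: "'a set \<Rightarrow> real"
  assumes "finite V" and "\<And>R. R \<subseteq> V \<Longrightarrow> card R > m \<Longrightarrow> g R = 0"
  shows "(\<Sum>R\<in>Pow V. g R) = (\<Sum>i\<le>m. \<Sum>R\<in>nsets V i. g R)"
proof -
  have "(\<Sum>R\<in>Pow V. g R) = (\<Sum>R\<in>{R \<in> Pow V. card R \<le> m}. g R)"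
    using assms by (intro sum.mono_neutral_right) (auto simp: not_le)
  also have "\<dots> = (\<Sum>i\<le>m. \<Sum>R\<in>{R \<in> {R \<in> Pow V. card R \<le> m}. card R = i}. g R)"
    using assms(1) by (intro sum.group[symmetric]) auto
  also have "\<dots> = (\<Sum>i\<le>m. \<Sum>R\<in>nsets V i. g R)"
    using assms(1) by (intro sum.cong) (auto simp: nsets_def intro: finite_subset)
  finally show ?thesis .
qed

lemma sum_Pow_alternating:
  assumes "finite T"
  shows "(\<Sum>R\<in>Pow T. (-1::real) ^ card R) = (if T = {} then 1 else 0)"
proof (cases "T = {}")
  case False
  then have "(\<Sum>R\<in>Pow T. (-1::real) ^ card R) = 0"
    using card_subsupersets_even_odd[of T "{}"] assms by (intro sum_alternating_cancels) auto
  with False show ?thesis by simp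
qed simp

lemma superset_sum_square:
  assumes "finite V"
  shows "(superset_sum V k f R)\<^sup>2
    = (\<Sum>p | p \<in> nsets V k \<times> nsets V k \<and> R \<subseteq> fst p \<inter> snd p. f (fst p) * f (snd p))"
proof -
  have "{A \<in> nsets V k. R \<subseteq> A} \<times> {A \<in> nsets V k. R \<subseteq> A}
      = {p. p \<in> nsets V k \<times> nsets V k \<and> R \<subseteq> fst p \<inter> snd p}"
    by auto
  then show ?thesis
    by (simp add: superset_sum_def power2_eq_square sum_product sum.cartesian_product split_def)
qed

lemma adjacency_form_disjnt:
  assumes fin: "finite V"
  shows "adjacency_form (nsets V k) disjnt f = (\<Sum>i\<le>k. (-1) ^ i * inclusion_energy V k f i)"
proof -
  let ?P = "nsets V k \<times> nsets V k"
  have "(\<Sum>i\<le>k. (-1) ^ i * inclusion_energy V k f i)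
      = (\<Sum>i\<le>k. \<Sum>R\<in>nsets V i. (-1) ^ card R * (superset_sum V k f R)\<^sup>2)"
    unfolding inclusion_energy_def sum_distrib_left by (intro sum.cong) (auto simp: nsets_def)
  also have "\<dots> = (\<Sum>R\<in>Pow V. (-1) ^ card R * (superset_sum V k f R)\<^sup>2)"
    using fin by (intro sum_Pow_eq_sum_nsets[symmetric]) (auto simp: superset_sum_eq_0)
  also have "\<dots> = (\<Sum>R\<in>Pow V. \<Sum>p | p \<in> ?P \<and> R \<subseteq> fst p \<inter> snd p.
      (-1) ^ card R * (f (fst p) * f (snd p)))"
    using fin by (simp add: superset_sum_square sum_distrib_left)
  also have "\<dots> = (\<Sum>p\<in>?P. \<Sum>R | R \<in> Pow V \<and> R \<subseteq> fst p \<inter> snd p.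
      (-1) ^ card R * (f (fst p) * f (snd p)))"
    using fin by (intro sum.swap_restrict) (auto intro: finite_imp_finite_nsets)
  also have "\<dots> = (\<Sum>p\<in>?P. (\<Sum>R\<in>Pow (fst p \<inter> snd p). (-1) ^ card R)
      * (f (fst p) * f (snd p)))"
    unfolding sum_distrib_right by (intro sum.cong refl) (auto simp: nsets_def subset_iff)
  also have "\<dots> = (\<Sum>p\<in>?P. if fst p \<inter> snd p = {} then f (fst p) * f (snd p) else 0)"
    by (intro sum.cong refl, subst sum_Pow_alternating) (auto simp: nsets_def)
  also have "\<dots> = (\<Sum>p\<in>adjacent_pairs (nsets V k) disjnt. f (fst p) * f (snd p))"
    using fin by (intro sum.mono_neutral_cong_right)
      (auto simp: adjacent_pairs_def disjnt_def intro: finite_imp_finite_nsets)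
  finally show ?thesis
    by (simp add: adjacency_form_def split_def)
qed

lemma sum_superset_sum_insert:
  assumes fin: "finite V"
  shows "(\<Sum>x\<in>V - R. superset_sum V k f (insert x R))
    = (real k - real (card R)) * superset_sum V k f R"
proof -
  have "(\<Sum>x\<in>V - R. superset_sum V k f (insert x R))
      = (\<Sum>A\<in>nsets V k. \<Sum>x | x \<in> V - R \<and> insert x R \<subseteq> A. f A)"
    unfolding superset_sum_def using fin
    by (intro sum.swap_restrict) (auto intro: finite_imp_finite_nsets)
  also have "\<dots> = (\<Sum>A | A \<in> nsets V k \<and> R \<subseteq> A. (real k - real (card R)) * f A)"
  proof (intro sum.mono_neutral_cong_right)
    fix A assume A: "A \<in> {A. A \<in> nsets V k \<and> R \<subseteq> A}"
    then have "{x. x \<in> V - R \<and> insert x R \<subseteq> A} = A - R"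
      by (auto simp: nsets_def)
    moreover have "real (card (A - R)) = real k - real (card R)"
      using A card_mono[of A R] by (auto simp: nsets_def card_Diff_subset finite_subset of_nat_diff)
    ultimately show "(\<Sum>x | x \<in> V - R \<and> insert x R \<subseteq> A. f A) = (real k - real (card R)) * f A"
      by simp
  qed (use fin in \<open>auto intro: finite_imp_finite_nsets\<close>)
  also have "\<dots> = (real k - real (card R)) * superset_sum V k f R"
    by (simp add: superset_sum_def sum_distrib_left)
  finally show ?thesis .
qed

lemma card_supersets_within:
  assumes "finite A" "R \<subseteq> A" "card R \<le> j"
  shows "card {T \<in> nsets A j. R \<subseteq> T} = (card A - card R) choose (j - card R)"
proof -
  have fin: "finite R" using assms finite_subset by blast
  have "bij_betw (\<lambda>T. T - R) {T \<in> nsets A j. R \<subseteq> T} (nsets (A - R) (j - card R))"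
  proof (rule bij_betw_byWitness[where f' = "\<lambda>T. T \<union> R"])
    show "(\<lambda>T. T \<union> R) ` nsets (A - R) (j - card R) \<subseteq> {T \<in> nsets A j. R \<subseteq> T}"
    proof clarsimp
      fix T assume T: "T \<in> nsets (A - R) (j - card R)"
      then have "card (T \<union> R) = card T + card R"
        using fin by (intro card_Un_disjoint) (auto simp: nsets_def)
      then show "T \<union> R \<in> nsets A j"
        using T assms fin by (auto simp: nsets_def)
    qed
  qed (use fin in \<open>auto simp: nsets_def card_Diff_subset\<close>)
  then show ?thesis
    using assms fin by (simp add: bij_betw_same_card card_Diff_subset)
qed

lemma superset_sum_superset_sum:
  assumes fin: "finite V" and R: "card R \<le> j"
  shows "superset_sum V j (superset_sum V k f) R
    = real ((k - card R) choose (j - card R)) * superset_sum V k f R"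
proof -
  have "superset_sum V j (superset_sum V k f) R
      = (\<Sum>A\<in>nsets V k. \<Sum>T | T \<in> {T \<in> nsets V j. R \<subseteq> T} \<and> T \<subseteq> A. f A)"
    unfolding superset_sum_def using fin
    by (subst sum.swap_restrict[symmetric]) (auto simp: finite_imp_finite_nsets)
  also have "\<dots> = (\<Sum>A | A \<in> nsets V k \<and> R \<subseteq> A. real ((k - card R) choose (j - card R)) * f A)"
  proof (intro sum.mono_neutral_cong_right)
    fix A assume A: "A \<in> {A. A \<in> nsets V k \<and> R \<subseteq> A}"
    then have "{T. T \<in> {T \<in> nsets V j. R \<subseteq> T} \<and> T \<subseteq> A} = {T \<in> nsets A j. R \<subseteq> T}"
      by (auto simp: nsets_def)
    then show "(\<Sum>T | T \<in> {T \<in> nsets V j. R \<subseteq> T} \<and> T \<subseteq> A. f A)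
        = real ((k - card R) choose (j - card R)) * f A"
      using A R card_supersets_within[of A R j] by (simp add: nsets_def)
  qed (use fin in \<open>auto simp: finite_imp_finite_nsets simp del: sum_constant intro!: sum.neutral\<close>)
  also have "\<dots> = real ((k - card R) choose (j - card R)) * superset_sum V k f R"
    by (simp add: superset_sum_def sum_distrib_left)
  finally show ?thesis .
qed

lemma sum_nsets_mult_sum_Pow:
  fixes g u :: "'a set \<Rightarrow> real"
  assumes fin: "finite V"
  shows "(\<Sum>T\<in>nsets V j. g T * (\<Sum>R\<in>Pow T. u R))
    = (\<Sum>i\<le>j. \<Sum>R\<in>nsets V i. u R * superset_sum V j g R)"
proof -
  have "(\<Sum>T\<in>nsets V j. g T * (\<Sum>R\<in>Pow T. u R))
      = (\<Sum>T\<in>nsets V j. \<Sum>R | R \<in> Pow V \<and> R \<subseteq> T. u R * g T)"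
    unfolding sum_distrib_left by (intro sum.cong refl) (auto simp: nsets_def)
  also have "\<dots> = (\<Sum>R\<in>Pow V. \<Sum>T | T \<in> nsets V j \<and> R \<subseteq> T. u R * g T)"
    using fin by (intro sum.swap_restrict) (auto intro: finite_imp_finite_nsets)
  also have "\<dots> = (\<Sum>R\<in>Pow V. u R * superset_sum V j g R)"
    by (simp add: superset_sum_def sum_distrib_left)
  also have "\<dots> = (\<Sum>i\<le>j. \<Sum>R\<in>nsets V i. u R * superset_sum V j g R)"
    using fin by (intro sum_Pow_eq_sum_nsets) (auto simp: superset_sum_eq_0)
  finally show ?thesis .
qed

section \<open>The spectrum of the Kneser graph\<close>

text \<open>
  Up to scaling, \<open>harmonic_part V k f j\<close> is the projection of \<open>f\<close> onto the \<open>j\<close>-th eigenspace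
  of the Johnson scheme, seen as a function on \<open>j\<close>-sets, and \<open>spectral_weight V k f j\<close> is the
  squared norm of this projection. The coefficients are determined by the condition that the
  values of \<open>harmonic_part V k f j\<close> on the \<open>j\<close>-sets above any \<open>(j - 1)\<close>-set sum to \<open>0\<close>.
\<close>

definition harmonic_coeff :: "nat \<Rightarrow> nat \<Rightarrow> nat \<Rightarrow> nat \<Rightarrow> real" where
  "harmonic_coeff n k j i
    = (-1) ^ (j - i) * real ((k - i) choose (j - i)) / real ((n + 1 - j - i) choose (j - i))"

definition harmonic_part :: "'a set \<Rightarrow> nat \<Rightarrow> ('a set \<Rightarrow> real) \<Rightarrow> nat \<Rightarrow> 'a set \<Rightarrow> real" where
  "harmonic_part V k f j T
    = (\<Sum>R\<in>Pow T. harmonic_coeff (card V) k j (card R) * superset_sum V k f R)"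

definition spectral_weight :: "'a set \<Rightarrow> nat \<Rightarrow> ('a set \<Rightarrow> real) \<Rightarrow> nat \<Rightarrow> real" where
  "spectral_weight V k f j
    = (\<Sum>T\<in>nsets V j. (harmonic_part V k f j T)\<^sup>2) / real ((card V - 2 * j) choose (k - j))"

lemma harmonic_coeff_self: "harmonic_coeff n k j j = 1"
  by (simp add: harmonic_coeff_def)

lemma harmonic_coeff_Suc:
  assumes "i < j" "j \<le> k" "2 * k \<le> n"
  shows "(real n + 1 - real j - real i) * harmonic_coeff n k j i
    + (real k - real i) * harmonic_coeff n k j (Suc i) = 0"
proof -
  define a b c where "a = k - Suc i" and "b = j - Suc i" and "c = n - j - i"
  have "b \<le> c" using assms by (auto simp: b_def c_def)
  have "k - i = Suc a" "j - i = Suc b" "n + 1 - j - i = Suc c" "n + 1 - j - Suc i = c"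
    using assms by (auto simp: a_def b_def c_def)
  then have coeff:
    "harmonic_coeff n k j i = - ((-1) ^ b) * real (Suc a choose Suc b) / real (Suc c choose Suc b)"
    "harmonic_coeff n k j (Suc i) = (-1) ^ b * real (a choose b) / real (c choose b)"
    unfolding harmonic_coeff_def by (simp_all only: power_Suc a_def b_def mult_minus1)
  have absorb: "real (Suc x choose Suc b) = real (Suc x) * real (x choose b) / real (Suc b)" for x
    using arg_cong[OF Suc_times_binomial[of b x], of real]
    by (simp add: field_simps del: binomial_Suc_Suc)
  have "real (Suc c) * harmonic_coeff n k j i + real (Suc a) * harmonic_coeff n k j (Suc i) = 0"
    unfolding coeff absorb using \<open>b \<le> c\<close> by (simp del: of_nat_Suc)
  moreover have "real n + 1 - real j - real i = real (Suc c)" "real k - real i = real (Suc a)"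
    using assms by (auto simp: a_def c_def of_nat_diff)
  ultimately show ?thesis by (simp only:)
qed

lemma sum_Pow_insert_within:
  fixes g :: "'a set \<Rightarrow> real"
  assumes "finite T"
  shows "(\<Sum>R\<in>Pow T. \<Sum>x\<in>T - R. g (insert x R)) = (\<Sum>R\<in>Pow T. real (card R) * g R)"
proof -
  have "(\<Sum>R\<in>Pow T. \<Sum>x\<in>T - R. g (insert x R))
      = (\<Sum>(R, x)\<in>(SIGMA R:Pow T. T - R). g (insert x R))"
    using assms by (subst sum.Sigma) auto
  also have "\<dots> = (\<Sum>(R, x)\<in>(SIGMA R:Pow T. R). g R)"
    by (rule sum.reindex_bij_witness[where i = "\<lambda>(R, x). (R - {x}, x)"
          and j = "\<lambda>(R, x). (insert x R, x)"]) (auto simp: insert_absorb)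
  also have "\<dots> = (\<Sum>R\<in>Pow T. \<Sum>x\<in>R. g R)"
    using assms by (subst sum.Sigma) (auto intro: finite_subset)
  finally show ?thesis by simp
qed

lemma sum_Pow_insert:
  fixes g :: "'a set \<Rightarrow> real"
  assumes "finite T" "x \<notin> T"
  shows "(\<Sum>R\<in>Pow (insert x T). g R) = (\<Sum>R\<in>Pow T. g R + g (insert x R))"
proof -
  have "inj_on (insert x) (Pow T)"
    using assms(2) by (auto simp: inj_on_def)
  moreover have "Pow T \<inter> insert x ` Pow T = {}"
    using assms(2) by auto
  ultimately show ?thesis
    using assms(1) by (simp add: Pow_insert sum.union_disjoint sum.reindex sum.distrib)
qed

lemma harmonic_part_insert:
  assumes fin: "finite T" and x: "x \<notin> T"
  shows "harmonic_part V k f j (insert x T)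
    = (\<Sum>R\<in>Pow T. harmonic_coeff (card V) k j (card R) * superset_sum V k f R
      + harmonic_coeff (card V) k j (Suc (card R)) * superset_sum V k f (insert x R))"
proof -
  have "card (insert x R) = Suc (card R)" if "R \<in> Pow T" for R
    using that fin x by (intro card_insert_disjoint) (auto intro: finite_subset)
  then show ?thesis
    unfolding harmonic_part_def using fin x by (simp add: sum_Pow_insert)
qed

lemma sum_superset_sum_insert_outside:
  assumes fin: "finite V" and "R \<subseteq> T" "T \<subseteq> V"
  shows "(\<Sum>x\<in>V - T. superset_sum V k f (insert x R))
    = (real k - real (card R)) * superset_sum V k f R - (\<Sum>x\<in>T - R. superset_sum V k f (insert x R))"
proof -
  have "V - R = (V - T) \<union> (T - R)" using assms by blast
  then have "(\<Sum>x\<in>V - R. superset_sum V k f (insert x R))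
      = (\<Sum>x\<in>V - T. superset_sum V k f (insert x R)) + (\<Sum>x\<in>T - R. superset_sum V k f (insert x R))"
    using fin assms(3) by (simp only:) (subst sum.union_disjoint, auto intro: finite_subset)
  then show ?thesis
    using sum_superset_sum_insert[OF fin, of k f R] by simp
qed

lemma sum_harmonic_part_insert:
  assumes fin: "finite V" and T: "T \<subseteq> V" "Suc (card T) = j" and j: "j \<le> k" "2 * k \<le> card V"
  shows "(\<Sum>x\<in>V - T. harmonic_part V k f j (insert x T)) = 0"
proof -
  let ?c = "harmonic_coeff (card V) k j" and ?F = "superset_sum V k f"
  have finT: "finite T" using T fin finite_subset by blast
  define m where "m = real (card (V - T))"
  have m: "m = real (card V) + 1 - real j"
    using T fin finT card_mono[of V T] by (simp add: m_def card_Diff_subset of_nat_diff)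
  have inside: "?c (Suc (card R)) * (\<Sum>x\<in>T - R. ?F (insert x R))
      = (\<Sum>x\<in>T - R. ?c (card (insert x R)) * ?F (insert x R))" if "R \<in> Pow T" for R
    using that finite_subset[OF _ finT, of R] unfolding sum_distrib_left by (intro sum.cong) auto
  have "(\<Sum>x\<in>V - T. harmonic_part V k f j (insert x T))
      = (\<Sum>x\<in>V - T. \<Sum>R\<in>Pow T. ?c (card R) * ?F R + ?c (Suc (card R)) * ?F (insert x R))"
    using finT by (simp add: harmonic_part_insert)
  also have "\<dots> = (\<Sum>R\<in>Pow T. m * (?c (card R) * ?F R)
      + ?c (Suc (card R)) * (\<Sum>x\<in>V - T. ?F (insert x R)))"
    by (subst sum.swap) (simp add: sum.distrib sum_distrib_left m_def)
  also have "\<dots> = (\<Sum>R\<in>Pow T. (m * ?c (card R)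
      + (real k - real (card R)) * ?c (Suc (card R))) * ?F R
      - (\<Sum>x\<in>T - R. ?c (card (insert x R)) * ?F (insert x R)))"
    using T fin by (intro sum.cong refl, subst inside[symmetric])
      (auto simp: sum_superset_sum_insert_outside algebra_simps)
  also have "\<dots> = (\<Sum>R\<in>Pow T. ((m - real (card R)) * ?c (card R)
      + (real k - real (card R)) * ?c (Suc (card R))) * ?F R)"
    unfolding sum_subtractf sum_Pow_insert_within[OF finT, of "\<lambda>R. ?c (card R) * ?F R"]
    unfolding sum_subtractf[symmetric] by (simp add: algebra_simps)
  also have "\<dots> = 0"
  proof (intro sum.neutral ballI)
    fix R assume "R \<in> Pow T"
    then have "card R < j" using T finT card_mono[of T R] by auto
    then show "((m - real (card R)) * ?c (card R)
        + (real k - real (card R)) * ?c (Suc (card R))) * ?F R = 0"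
      unfolding m using harmonic_coeff_Suc[OF _ j, of "card R"] by (simp only: mult_zero_left)
  qed
  finally show ?thesis .
qed

lemma superset_sum_harmonic_eq_0:
  assumes fin: "finite V"
    and harmonic: "\<And>T. T \<subseteq> V \<Longrightarrow> Suc (card T) = j \<Longrightarrow> (\<Sum>x\<in>V - T. h (insert x T)) = 0"
  shows "R \<subseteq> V \<Longrightarrow> card R < j \<Longrightarrow> superset_sum V j h R = 0"
proof (induction "j - card R" arbitrary: R rule: less_induct)
  case less
  have finR: "finite R" using less.prems fin finite_subset by blast
  have "(\<Sum>x\<in>V - R. superset_sum V j h (insert x R)) = 0"
  proof (cases "Suc (card R) = j")
    case True
    have "(\<Sum>x\<in>V - R. superset_sum V j h (insert x R)) = (\<Sum>x\<in>V - R. h (insert x R))"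
      using True less.prems finR by (intro sum.cong refl superset_sum_self) (auto simp: nsets_def)
    then show ?thesis using harmonic[OF less.prems(1) True] by simp
  next
    case False
    then show ?thesis using less finR by (intro sum.neutral ballI less.hyps) auto
  qed
  then show ?case
    using sum_superset_sum_insert[OF fin, of j h R] less.prems(2) by simp
qed

lemma sum_harmonic_part_squares:
  assumes fin: "finite V" and j: "j \<le> k" "2 * k \<le> card V"
  shows "(\<Sum>T\<in>nsets V j. (harmonic_part V k f j T)\<^sup>2)
    = (\<Sum>i\<le>j. harmonic_coeff (card V) k j i * real ((k - i) choose (j - i))
      * inclusion_energy V k f i)"
proof -
  let ?c = "harmonic_coeff (card V) k j"
  let ?F = "superset_sum V k f" and ?h = "harmonic_part V k f j"
  have pairing: "(\<Sum>T\<in>nsets V j. g T * ?h T)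
      = (\<Sum>i\<le>j. \<Sum>R\<in>nsets V i. ?c (card R) * ?F R * superset_sum V j g R)" for g
    unfolding harmonic_part_def by (rule sum_nsets_mult_sum_Pow[OF fin])
  have below: "superset_sum V j ?h R = 0" if "R \<subseteq> V" "card R < j" for R
    using superset_sum_harmonic_eq_0[OF fin sum_harmonic_part_insert[OF fin _ _ j]] that by blast
  have "(\<Sum>T\<in>nsets V j. (?h T)\<^sup>2)
      = (\<Sum>i\<le>j. \<Sum>R\<in>nsets V i. ?c (card R) * ?F R * superset_sum V j ?h R)"
    by (simp add: power2_eq_square pairing)
  also have "\<dots> = (\<Sum>i\<le>j. if i = j then \<Sum>R\<in>nsets V j. ?F R * ?h R else 0)"
    using below by (intro sum.cong)
      (auto simp: nsets_def superset_sum_self harmonic_coeff_self intro!: sum.neutral sum.cong)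
  also have "\<dots> = (\<Sum>T\<in>nsets V j. ?F T * ?h T)"
    by simp
  also have "\<dots> = (\<Sum>i\<le>j. \<Sum>R\<in>nsets V i. ?c (card R) * ?F R * superset_sum V j ?F R)"
    by (rule pairing)
  also have "\<dots> = (\<Sum>i\<le>j. ?c i * real ((k - i) choose (j - i)) * inclusion_energy V k f i)"
    unfolding inclusion_energy_def sum_distrib_left
    by (intro sum.cong refl)
      (auto simp: nsets_def superset_sum_superset_sum[OF fin] power2_eq_square)
  finally show ?thesis .
qed

text \<open>The right-hand side vanishes for \<open>r = Suc m\<close>, which gives the orthogonality relation below.\<close>

lemma sum_alternating_telescope:
  assumes "2 * Suc m \<le> M" "r \<le> Suc m"
  shows "(\<Sum>s\<le>r. (-1) ^ s * real (Suc m choose s) * (real M + 1 - 2 * real s)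
      * fact (M - Suc m - s) / fact (M + 1 - s))
    = ((-1) ^ r * real (m choose r) * fact (M - Suc m - r) / fact (M - r) :: real)"
  using assms(2)
proof (induction r)
  case 0
  then show ?case by (simp add: add.commute)
next
  case (Suc r)
  define b d u v where "b = M - Suc m - Suc r" and "d = M - Suc r"
    and "u = real (m choose r)" and "v = real (m choose Suc r)"
  have "Suc r * (m choose Suc r) = (m - r) * (m choose r)"
    using binomial_absorption[of r m] binomial_absorb_comp[of m r] by simp
  then have "real (Suc r) * v = real (m - r) * u"
    unfolding u_def v_def by (metis of_nat_mult)
  then have uv: "(real r + 1) * v = (real m - real r) * u"
    using Suc.prems by (simp add: of_nat_diff add.commute)
  have idx: "M - Suc m - r = Suc b" "M - r = Suc d" "M + 1 - Suc r = Suc d"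
    using Suc.prems assms(1) by (auto simp: b_def d_def)
  have bd: "real b + 1 = real M - real m - real r - 1" "real d + 1 = real M - real r"
    using Suc.prems assms(1) by (auto simp: b_def d_def of_nat_diff)
  have step: "(u + v) * (real M + 1 - 2 * real (Suc r)) - u * (real b + 1) = v * (real d + 1)"
    unfolding bd using uv by (simp add: algebra_simps)
  have "(\<Sum>s\<le>Suc r. (-1) ^ s * real (Suc m choose s) * (real M + 1 - 2 * real s)
      * fact (M - Suc m - s) / fact (M + 1 - s))
    = (-1) ^ r * u * fact (Suc b) / fact (Suc d)
      + (-1) ^ Suc r * (u + v) * (real M + 1 - 2 * real (Suc r)) * fact b / (fact (Suc d) :: real)"
    using Suc unfolding sum.atMost_Suc idx by (simp add: u_def v_def b_def)
  also have "\<dots> = (-1) ^ Suc r * fact b / fact (Suc d)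
      * ((u + v) * (real M + 1 - 2 * real (Suc r)) - u * (real b + 1))"
    by (simp add: algebra_simps add_divide_distrib diff_divide_distrib)
  also have "\<dots> = (-1) ^ Suc r * v * fact b / fact d"
    unfolding step by (simp add: add.commute)
  finally show ?case unfolding v_def b_def d_def .
qed

lemma sum_alternating_orthogonality:
  assumes "l \<le> i" "2 * i \<le> n"
  shows "(\<Sum>j=l..i. (-1) ^ (j - l) * (real n + 1 - 2 * real j) * fact (n - i - j)
      / (fact (i - j) * fact (j - l) * fact (n + 1 - j - l)))
    = (if l = i then 1 else 0 :: real)"
proof (cases "l = i")
  case True
  define e where "e = n - 2 * i"
  have "n - i - i = e" "n + 1 - i - i = Suc e" "real n + 1 - 2 * real i = real (Suc e)"
    using assms(2) by (auto simp: e_def of_nat_diff)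
  then show ?thesis using True by (simp del: of_nat_Suc)
next
  case False
  define m M where "m = i - l - 1" and "M = n - 2 * l"
  have i: "i = l + Suc m" and mM: "2 * Suc m \<le> M" and n: "n = M + 2 * l"
    using assms False by (auto simp: m_def M_def)
  have "(\<Sum>j=l..i. (-1) ^ (j - l) * (real n + 1 - 2 * real j) * fact (n - i - j)
      / (fact (i - j) * fact (j - l) * fact (n + 1 - j - l)))
    = (\<Sum>s\<le>Suc m. (-1) ^ s * real (Suc m choose s) * (real M + 1 - 2 * real s)
      * fact (M - Suc m - s) / fact (M + 1 - s) / fact (Suc m) :: real)"
  proof (rule sum.reindex_bij_witness[where i = "\<lambda>s. l + s" and j = "\<lambda>j. j - l"])
    fix j assume "j \<in> {l..i}"
    then obtain s where s: "j = l + s" "s \<le> Suc m"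
      by (metis i atLeastAtMost_iff add_le_cancel_left le_Suc_ex)
    have "n - i - j = M - Suc m - s" "n + 1 - j - l = M + 1 - s" "i - j = Suc m - s" "j - l = s"
      "real n + 1 - 2 * real j = real M + 1 - 2 * real s"
      using s i n by auto
    then show "(-1) ^ (j - l) * real (Suc m choose (j - l)) * (real M + 1 - 2 * real (j - l))
        * fact (M - Suc m - (j - l)) / fact (M + 1 - (j - l)) / fact (Suc m)
      = (-1) ^ (j - l) * (real n + 1 - 2 * real j) * fact (n - i - j)
        / (fact (i - j) * fact (j - l) * fact (n + 1 - j - l))"
      by (simp add: binomial_fact[OF s(2)] mult_ac del: binomial_Suc_Suc fact_Suc)
  qed (use i in auto)
  also have "\<dots> = 0"
    unfolding sum_divide_distrib[symmetric] sum_alternating_telescope[OF mM order_refl] by simp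
  finally show ?thesis using False by simp
qed

definition inclusion_eigenvalue :: "nat \<Rightarrow> nat \<Rightarrow> nat \<Rightarrow> nat \<Rightarrow> real" where
  "inclusion_eigenvalue n k i j = real ((k - j) choose (i - j)) * real ((n - i - j) choose (k - i))"

lemma inclusion_eigenvalue_harmonic_coeff:
  assumes "l \<le> j" "j \<le> i" "i \<le> k" "2 * k \<le> n"
  shows "inclusion_eigenvalue n k i j / real ((n - 2 * j) choose (k - j))
      * (harmonic_coeff n k j l * real ((k - l) choose (j - l)))
    = (fact (k - l) / fact (k - i))\<^sup>2
      * ((-1) ^ (j - l) * (real n + 1 - 2 * real j) * fact (n - i - j)
        / (fact (i - j) * fact (j - l) * fact (n + 1 - j - l)))"
proof -
  define e where "e = n - 2 * j"
  have "n - 2 * j = e" "k - j - (i - j) = k - i" "n - i - j - (k - i) = e - (k - j)"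
    "k - l - (j - l) = k - j" "n + 1 - j - l - (j - l) = Suc e"
    and "i - j \<le> k - j" "k - i \<le> n - i - j" "k - j \<le> e" "j - l \<le> k - l" "j - l \<le> n + 1 - j - l"
    and "real n + 1 - 2 * real j = real (Suc e)"
    using assms by (auto simp: e_def of_nat_diff)
  then show ?thesis
    by (simp add: inclusion_eigenvalue_def harmonic_coeff_def binomial_fact power2_eq_square
      field_simps del: of_nat_Suc)
qed

lemma inclusion_energy_spectral:
  assumes "finite V" "i \<le> k" "2 * k \<le> card V"
  shows "inclusion_energy V k f i
    = (\<Sum>j\<le>i. inclusion_eigenvalue (card V) k i j * spectral_weight V k f j)"
proof -
  let ?n = "card V" and ?q = "inclusion_energy V k f"
  define M where "M j = inclusion_eigenvalue ?n k i j / real ((?n - 2 * j) choose (k - j))" for j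
  define c where "c j l = harmonic_coeff ?n k j l * real ((k - l) choose (j - l))" for j l
  have "(\<Sum>j\<le>i. inclusion_eigenvalue ?n k i j * spectral_weight V k f j)
      = (\<Sum>j\<le>i. M j * (\<Sum>l\<le>j. c j l * ?q l))"
    using assms unfolding spectral_weight_def M_def c_def
    by (intro sum.cong refl) (simp add: sum_harmonic_part_squares)
  also have "\<dots> = (\<Sum>j\<in>{..i}. \<Sum>l | l \<in> {..i} \<and> l \<le> j. M j * c j l * ?q l)"
    unfolding sum_distrib_left mult.assoc by (intro sum.cong refl) auto
  also have "\<dots> = (\<Sum>l\<in>{..i}. \<Sum>j | j \<in> {..i} \<and> l \<le> j. M j * c j l * ?q l)"
    by (intro sum.swap_restrict) auto
  also have "\<dots> = (\<Sum>l\<le>i. (\<Sum>j=l..i. M j * c j l) * ?q l)"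
    unfolding sum_distrib_right by (intro sum.cong) auto
  also have "\<dots> = (\<Sum>l\<le>i. if l = i then ?q i else 0)"
  proof (intro sum.cong refl)
    fix l assume "l \<in> {..i}"
    then have l: "l \<le> i" by simp
    have "(\<Sum>j=l..i. M j * c j l) = (\<Sum>j=l..i. (fact (k - l) / fact (k - i))\<^sup>2
        * ((-1) ^ (j - l) * (real ?n + 1 - 2 * real j) * fact (?n - i - j)
          / (fact (i - j) * fact (j - l) * fact (?n + 1 - j - l))))"
      unfolding M_def c_def using assms
      by (intro sum.cong refl inclusion_eigenvalue_harmonic_coeff) auto
    also have "\<dots> = (fact (k - l) / fact (k - i))\<^sup>2 * (if l = i then 1 else 0)"
      using sum_alternating_orthogonality[OF l, of ?n] assms
      unfolding sum_distrib_left[symmetric] by simp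
    finally show "(\<Sum>j=l..i. M j * c j l) * ?q l = (if l = i then ?q i else 0)"
      by simp
  qed
  finally show ?thesis by simp
qed

lemma sum_alternating_choose_Suc:
  fixes g :: "nat \<Rightarrow> real"
  shows "(\<Sum>r\<le>Suc m. (-1) ^ r * real (Suc m choose r) * g r)
    = (\<Sum>r\<le>m. (-1) ^ r * real (m choose r) * (g r - g (Suc r)))"
proof -
  have "(\<Sum>r\<le>Suc m. (-1) ^ r * real (Suc m choose r) * g r)
      = g 0 + (\<Sum>r\<le>m. (-1) ^ Suc r * real (m choose Suc r) * g (Suc r))
        - (\<Sum>r\<le>m. (-1) ^ r * real (m choose r) * g (Suc r))"
    unfolding sum.atMost_Suc_shift by (simp add: algebra_simps sum.distrib sum_subtractf sum_negf)
  also have "g 0 + (\<Sum>r\<le>m. (-1) ^ Suc r * real (m choose Suc r) * g (Suc r))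
      = (\<Sum>r\<le>m. (-1) ^ r * real (m choose r) * g r)"
    using sum.atMost_Suc_shift[of "\<lambda>r. (-1) ^ r * real (m choose r) * g r" m]
    by (simp add: binomial_eq_0)
  finally show ?thesis
    by (simp add: right_diff_distrib sum_subtractf del: sum.atMost_Suc)
qed

lemma sum_alternating_choose:
  "(\<Sum>r\<le>m. (-1) ^ r * real (m choose r) * real ((a + m - r) choose (p + m))) = real (a choose p)"
proof (induction m)
  case (Suc m)
  have "real ((a + Suc m - r) choose (p + Suc m)) - real ((a + Suc m - Suc r) choose (p + Suc m))
      = real ((a + m - r) choose (p + m))" if "r \<le> m" for r
    using that by (simp add: Suc_diff_le)
  then show ?case
    unfolding sum_alternating_choose_Suc using Suc by simp
qed simp

definition kneser_eigenvalue :: "nat \<Rightarrow> nat \<Rightarrow> nat \<Rightarrow> real" where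
  "kneser_eigenvalue n k j = (-1) ^ j * real ((n - k - j) choose (k - j))"

lemma sum_inclusion_eigenvalues:
  assumes "j \<le> k" "2 * k \<le> n"
  shows "(\<Sum>i=j..k. (-1) ^ i * inclusion_eigenvalue n k i j) = kneser_eigenvalue n k j"
proof -
  define m a where "m = k - j" and "a = n - k - j"
  have "(\<Sum>i=j..k. (-1) ^ i * inclusion_eigenvalue n k i j)
      = (\<Sum>r\<le>m. (-1) ^ j * ((-1) ^ r * real (m choose r) * real ((a + m - r) choose (a - m + m))))"
  proof (rule sum.reindex_bij_witness[where i = "\<lambda>r. j + r" and j = "\<lambda>i. i - j"])
    fix i assume i: "i \<in> {j..k}"
    have "(n - i - j) choose (k - i) = (n - i - j) choose (n - i - j - (k - i))"
      using i assms by (intro binomial_symmetric) auto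
    moreover have "n - i - j - (k - i) = a - m + m" "n - i - j = a + m - (i - j)"
      using i assms by (auto simp: m_def a_def)
    moreover have "(-1) ^ i = (-1) ^ j * ((-1) ^ (i - j) :: real)"
      using i by (simp flip: power_add)
    ultimately show "(-1) ^ j * ((-1) ^ (i - j) * real (m choose (i - j))
        * real ((a + m - (i - j)) choose (a - m + m))) = (-1) ^ i * inclusion_eigenvalue n k i j"
      by (simp add: inclusion_eigenvalue_def m_def)
  qed (use assms in \<open>auto simp: m_def\<close>)
  also have "\<dots> = (-1) ^ j * real (a choose (a - m))"
    by (simp add: sum_alternating_choose flip: sum_distrib_left)
  also have "a choose (a - m) = a choose m"
    using assms binomial_symmetric[of m a] by (simp add: a_def m_def)
  finally show ?thesis by (simp add: kneser_eigenvalue_def a_def m_def)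
qed

lemma spectral_weight_nonneg: "spectral_weight V k f j \<ge> 0"
  unfolding spectral_weight_def by (intro divide_nonneg_nonneg sum_nonneg) auto

lemma spectral_weight_0:
  assumes "finite V" "2 * k \<le> card V"
  shows "spectral_weight V k f 0 = (\<Sum>A\<in>nsets V k. f A)\<^sup>2 / real (card V choose k)"
  using inclusion_energy_spectral[OF assms(1) le0 assms(2), of f] assms(2)
  by (simp add: inclusion_energy_0 inclusion_eigenvalue_def)

lemma sum_squares_spectral:
  assumes "finite V" "2 * k \<le> card V"
  shows "(\<Sum>A\<in>nsets V k. (f A)\<^sup>2) = (\<Sum>j\<le>k. spectral_weight V k f j)"
  using inclusion_energy_spectral[OF assms(1) order_refl assms(2), of f]
  by (simp add: inclusion_energy_top inclusion_eigenvalue_def)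

lemma adjacency_form_disjnt_spectral:
  assumes fin: "finite V" and n: "2 * k \<le> card V"
  shows "adjacency_form (nsets V k) disjnt f
    = (\<Sum>j\<le>k. kneser_eigenvalue (card V) k j * spectral_weight V k f j)"
proof -
  let ?\<mu> = "inclusion_eigenvalue (card V) k" and ?w = "spectral_weight V k f"
  have "(-1) ^ i * inclusion_energy V k f i
      = (\<Sum>j | j \<in> {..k} \<and> j \<le> i. (-1) ^ i * ?\<mu> i j * ?w j)" if "i \<le> k" for i
    using that by (auto simp: inclusion_energy_spectral[OF fin _ n] sum_distrib_left mult.assoc
      intro!: sum.cong)
  then have "adjacency_form (nsets V k) disjnt f
      = (\<Sum>i\<in>{..k}. \<Sum>j | j \<in> {..k} \<and> j \<le> i. (-1) ^ i * ?\<mu> i j * ?w j)"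
    by (simp add: adjacency_form_disjnt[OF fin])
  also have "\<dots> = (\<Sum>j\<in>{..k}. \<Sum>i | i \<in> {..k} \<and> j \<le> i. (-1) ^ i * ?\<mu> i j * ?w j)"
    by (intro sum.swap_restrict) auto
  also have "\<dots> = (\<Sum>j\<le>k. (\<Sum>i=j..k. (-1) ^ i * ?\<mu> i j) * ?w j)"
    unfolding sum_distrib_right by (intro sum.cong) auto
  also have "\<dots> = (\<Sum>j\<le>k. kneser_eigenvalue (card V) k j * ?w j)"
    using n by (intro sum.cong refl) (simp add: sum_inclusion_eigenvalues)
  finally show ?thesis .
qed

text \<open>
  For a \<open>d\<close>-regular graph these say that every eigenvalue of the adjacency matrix on the orthogonal
  complement of the constant functions is at least \<open>\<mu>\<close>, respectively at most \<open>\<theta>\<close>.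
\<close>

definition nontrivial_eigenvalues_ge :: "'a set \<Rightarrow> ('a \<Rightarrow> 'a \<Rightarrow> bool) \<Rightarrow> real \<Rightarrow> real \<Rightarrow> bool" where
  "nontrivial_eigenvalues_ge V E d \<mu> \<longleftrightarrow>
    (\<forall>f. \<mu> * (\<Sum>u\<in>V. (f u)\<^sup>2) + (d - \<mu>) / real (card V) * (\<Sum>u\<in>V. f u)\<^sup>2 \<le> adjacency_form V E f)"

definition nontrivial_eigenvalues_le :: "'a set \<Rightarrow> ('a \<Rightarrow> 'a \<Rightarrow> bool) \<Rightarrow> real \<Rightarrow> real \<Rightarrow> bool" where
  "nontrivial_eigenvalues_le V E d \<theta> \<longleftrightarrow>
    (\<forall>f. adjacency_form V E f \<le> \<theta> * (\<Sum>u\<in>V. (f u)\<^sup>2) + (d - \<theta>) / real (card V) * (\<Sum>u\<in>V. f u)\<^sup>2)"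

lemma adjacency_form_disjnt_minus_principal:
  assumes "finite V" "2 * k \<le> card V"
  shows "adjacency_form (nsets V k) disjnt f - (\<mu> * (\<Sum>A\<in>nsets V k. (f A)\<^sup>2)
      + (real ((card V - k) choose k) - \<mu>) / real (card (nsets V k)) * (\<Sum>A\<in>nsets V k. f A)\<^sup>2)
    = (\<Sum>j=1..k. (kneser_eigenvalue (card V) k j - \<mu>) * spectral_weight V k f j)"
proof -
  have "(\<Sum>j\<le>k. g j) = g 0 + (\<Sum>j=1..k. g j)" for g :: "nat \<Rightarrow> real"
    by (simp add: atMost_atLeast0 sum.atLeast_Suc_atMost)
  moreover have "kneser_eigenvalue (card V) k 0 = real ((card V - k) choose k)"
    by (simp add: kneser_eigenvalue_def)
  ultimately show ?thesis
    using assms by (simp add: adjacency_form_disjnt_spectral sum_squares_spectral spectral_weight_0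
      sum_distrib_left sum_subtractf left_diff_distrib diff_divide_distrib distrib_left)
qed

lemma nontrivial_eigenvalues_ge_disjnt:
  assumes "finite V" "2 * k \<le> card V"
    and "\<And>j. 1 \<le> j \<Longrightarrow> j \<le> k \<Longrightarrow> \<mu> \<le> kneser_eigenvalue (card V) k j"
  shows "nontrivial_eigenvalues_ge (nsets V k) disjnt (real ((card V - k) choose k)) \<mu>"
  unfolding nontrivial_eigenvalues_ge_def
proof
  fix f
  have "0 \<le> (\<Sum>j=1..k. (kneser_eigenvalue (card V) k j - \<mu>) * spectral_weight V k f j)"
    using assms(3) by (intro sum_nonneg mult_nonneg_nonneg spectral_weight_nonneg) simp
  then show "\<mu> * (\<Sum>A\<in>nsets V k. (f A)\<^sup>2)
      + (real ((card V - k) choose k) - \<mu>) / real (card (nsets V k)) * (\<Sum>A\<in>nsets V k. f A)\<^sup>2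
    \<le> adjacency_form (nsets V k) disjnt f"
    unfolding adjacency_form_disjnt_minus_principal[OF assms(1,2), symmetric] by simp
qed

lemma nontrivial_eigenvalues_le_disjnt:
  assumes "finite V" "2 * k \<le> card V"
    and "\<And>j. 1 \<le> j \<Longrightarrow> j \<le> k \<Longrightarrow> kneser_eigenvalue (card V) k j \<le> \<theta>"
  shows "nontrivial_eigenvalues_le (nsets V k) disjnt (real ((card V - k) choose k)) \<theta>"
  unfolding nontrivial_eigenvalues_le_def
proof
  fix f
  have "(\<Sum>j=1..k. (kneser_eigenvalue (card V) k j - \<theta>) * spectral_weight V k f j) \<le> 0"
    using assms(3) by (intro sum_nonpos mult_nonpos_nonneg spectral_weight_nonneg) simp
  then show "adjacency_form (nsets V k) disjnt f
    \<le> \<theta> * (\<Sum>A\<in>nsets V k. (f A)\<^sup>2)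
      + (real ((card V - k) choose k) - \<theta>) / real (card (nsets V k)) * (\<Sum>A\<in>nsets V k. f A)\<^sup>2"
    unfolding adjacency_form_disjnt_minus_principal[OF assms(1,2), symmetric] by simp
qed

lemma binomial_diagonal_mono: "a choose b \<le> (a + c) choose (b + c)"
proof (induction c)
  case (Suc c)
  have "(a + c) choose (b + c) \<le> (a + Suc c) choose (b + Suc c)" by simp
  with Suc show ?case by (rule order_trans)
qed simp

lemma kneser_eigenvalue_ge:
  assumes "1 \<le> j" "j \<le> k" "2 * k \<le> n"
  shows "- real ((n - k - 1) choose (k - 1)) \<le> kneser_eigenvalue n k j"
proof -
  have "(n - k - j) choose (k - j) \<le> (n - k - 1) choose (k - 1)"
    using binomial_diagonal_mono[of "n - k - j" "k - j" "j - 1"] assms by simp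
  then show ?thesis by (cases "even j") (auto simp: kneser_eigenvalue_def)
qed

lemma kneser_eigenvalue_le:
  assumes "1 \<le> j" "j \<le> k" "2 * k \<le> n"
  shows "kneser_eigenvalue n k j \<le> real ((n - k - 2) choose (k - 2))"
proof (cases "even j")
  case True
  then have "2 \<le> j" using assms by (cases "j = 1") auto
  then have "(n - k - j) choose (k - j) \<le> (n - k - 2) choose (k - 2)"
    using binomial_diagonal_mono[of "n - k - j" "k - j" "j - 2"] assms by simp
  with True show ?thesis by (simp add: kneser_eigenvalue_def)
next
  case False
  then have "kneser_eigenvalue n k j \<le> 0" by (simp add: kneser_eigenvalue_def)
  then show ?thesis using of_nat_0_le_iff order_trans by blast
qed

lemma kneser_verts_eq_nsets: "kneser_verts n k = nsets {1..n} k"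
  by (auto simp: kneser_verts_def nsets_def intro: finite_subset)

lemma kneser_adj_eq_disjnt: "kneser_adj = disjnt"
  by (intro ext) (simp add: kneser_adj_def disjnt_def)

lemma kneser_nontrivial_eigenvalues_ge:
  assumes "2 * k \<le> n"
  shows "nontrivial_eigenvalues_ge (kneser_verts n k) kneser_adj
    (real ((n - k) choose k)) (- real ((n - k - 1) choose (k - 1)))"
  using nontrivial_eigenvalues_ge_disjnt[of "{1..n}" k, OF _ _ kneser_eigenvalue_ge] assms
  by (simp add: kneser_verts_eq_nsets kneser_adj_eq_disjnt)

lemma kneser_nontrivial_eigenvalues_le:
  assumes "2 * k \<le> n"
  shows "nontrivial_eigenvalues_le (kneser_verts n k) kneser_adj
    (real ((n - k) choose k)) (real ((n - k - 2) choose (k - 2)))"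
  using nontrivial_eigenvalues_le_disjnt[of "{1..n}" k, OF _ _ kneser_eigenvalue_le] assms
  by (simp add: kneser_verts_eq_nsets kneser_adj_eq_disjnt)

section \<open>Components left by a vertex cut\<close>

definition components :: "'a set \<Rightarrow> ('a \<Rightarrow> 'a \<Rightarrow> bool) \<Rightarrow> 'a set set" where
  "components V E = V // conn_rel V E"

definition component_function :: "'a set \<Rightarrow> ('a \<Rightarrow> 'a \<Rightarrow> bool) \<Rightarrow> ('a set \<Rightarrow> real) \<Rightarrow> 'a \<Rightarrow> real" where
  "component_function V E b u = (if u \<in> V then b (conn_rel V E `` {u}) else 0)"

definition cut_ratio :: "'a set \<Rightarrow> ('a \<Rightarrow> 'a \<Rightarrow> bool) \<Rightarrow> 'a set \<Rightarrow> real" where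
  "cut_ratio V E S = real (card S) / real (num_components (V - S) E)"

lemma num_components_eq_card: "num_components V E = card (components V E)"
  by (simp add: num_components_def components_def)

lemma finite_components: "finite V \<Longrightarrow> finite (components V E)"
  unfolding components_def by (rule finite_quotient) (auto simp: conn_rel_def)

lemma equiv_conn_rel:
  assumes "symp E"
  shows "equiv V (conn_rel V E)"
proof -
  have "symp (\<lambda>a b. a \<in> V \<and> b \<in> V \<and> E a b)\<^sup>*\<^sup>*"
    using assms by (intro symp_rtranclp) (auto simp: symp_def)
  then show ?thesis
    unfolding conn_rel_def
    by (intro equivI refl_onI symI transI) (auto dest: sympD rtranclp_trans)
qed

lemma component_subset: "symp E \<Longrightarrow> C \<in> components V E \<Longrightarrow> C \<subseteq> V"
  unfolding components_def by (rule in_quotient_imp_subset[OF equiv_conn_rel])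

lemma component_nonempty: "symp E \<Longrightarrow> C \<in> components V E \<Longrightarrow> C \<noteq> {}"
  unfolding components_def by (rule in_quotient_imp_non_empty[OF equiv_conn_rel])

lemma Union_components: "symp E \<Longrightarrow> \<Union> (components V E) = V"
  unfolding components_def by (rule Union_quotient[OF equiv_conn_rel])

lemma components_disjoint:
  "symp E \<Longrightarrow> C \<in> components V E \<Longrightarrow> D \<in> components V E \<Longrightarrow> C \<noteq> D \<Longrightarrow> C \<inter> D = {}"
  unfolding components_def using quotient_disj[OF equiv_conn_rel] by blast

lemma component_card_pos:
  assumes "symp E" "finite V" "C \<in> components V E"
  shows "card C > 0"
  using component_nonempty[OF assms(1,3)] finite_subset[OF component_subset[OF assms(1,3)] assms(2)]
  by (simp add: card_gt_0_iff)

lemma component_closed: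
  assumes "symp E" "C \<in> components V E" "u \<in> C" "v \<in> V" "E u v"
  shows "v \<in> C"
proof -
  have "u \<in> V" using component_subset assms by blast
  then have "(u, v) \<in> conn_rel V E" using assms by (auto simp: conn_rel_def)
  then show ?thesis
    using in_quotient_imp_closed[OF equiv_conn_rel[OF assms(1)]] assms(2,3)
    by (metis components_def)
qed

lemma sum_components:
  assumes "symp E" "finite V"
  shows "(\<Sum>u\<in>V. g u) = (\<Sum>C\<in>components V E. \<Sum>u\<in>C. g u)"
proof -
  have "(\<Sum>u\<in>\<Union> (components V E). g u) = (\<Sum>C\<in>components V E. \<Sum>u\<in>C. g u)"
    using components_disjoint[OF assms(1)] component_subset[OF assms(1)]
      finite_subset[OF _ assms(2)]
    by (subst sum.Union_disjoint) auto
  then show ?thesis by (simp add: Union_components assms(1))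
qed

lemma sum_adjacent_pairs_components:
  assumes sym: "symp E" and fin: "finite V"
  shows "(\<Sum>p\<in>adjacent_pairs V E. g p) = (\<Sum>C\<in>components V E. \<Sum>p\<in>adjacent_pairs C E. g p)"
proof -
  have "adjacent_pairs V E = (\<Union>C\<in>components V E. adjacent_pairs C E)"
  proof (intro equalityI subsetI)
    fix p assume "p \<in> adjacent_pairs V E"
    then obtain u v where p: "p = (u, v)" "u \<in> V" "v \<in> V" "E u v" by (auto simp: adjacent_pairs_def)
    then have "u \<in> \<Union> (components V E)" by (simp add: Union_components[OF sym])
    then obtain C where C: "C \<in> components V E" "u \<in> C" by blast
    then have "v \<in> C" using component_closed[OF sym _ _ p(3,4)] by blast
    with p C show "p \<in> (\<Union>C\<in>components V E. adjacent_pairs C E)" by (auto simp: adjacent_pairs_def)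
  qed (auto simp: adjacent_pairs_def dest: component_subset[OF sym, THEN subsetD])
  then have "(\<Sum>p\<in>adjacent_pairs V E. g p) = (\<Sum>p\<in>(\<Union>C\<in>components V E. adjacent_pairs C E). g p)"
    by simp
  also have "\<dots> = (\<Sum>C\<in>components V E. \<Sum>p\<in>adjacent_pairs C E. g p)"
  proof (rule sum.UNION_disjoint[OF finite_components[OF fin]]; intro ballI impI)
    show "finite (adjacent_pairs C E)" if "C \<in> components V E" for C
      using component_subset[OF sym that] fin finite_subset finite_adjacent_pairs by blast
    show "adjacent_pairs C E \<inter> adjacent_pairs D E = {}"
      if "C \<in> components V E" "D \<in> components V E" "C \<noteq> D" for C D
      using components_disjoint[OF sym that] by (auto simp: adjacent_pairs_def)
  qed
  finally show ?thesis .
qed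

lemma component_function_eq:
  assumes sym: "symp E" and C: "C \<in> components V E" "u \<in> C"
  shows "component_function V E b u = b C"
proof -
  obtain w where "w \<in> V" and w: "C = conn_rel V E `` {w}"
    using C(1) unfolding components_def by (rule quotientE)
  then have "conn_rel V E `` {u} = C"
    using C(2) equiv_class_eq[OF equiv_conn_rel[OF sym], of w u] by simp
  moreover have "u \<in> V" using component_subset[OF sym] C by blast
  ultimately show ?thesis by (simp add: component_function_def)
qed

lemma sum_component_function:
  assumes "symp E" "finite V" "X \<subseteq> V" and "h 0 = (0 :: real)"
  shows "(\<Sum>u\<in>V. h (component_function X E b u)) = (\<Sum>C\<in>components X E. real (card C) * h (b C))"
proof -
  have "(\<Sum>u\<in>V. h (component_function X E b u)) = (\<Sum>u\<in>X. h (component_function X E b u))"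
    using assms by (intro sum.mono_neutral_right) (auto simp: component_function_def)
  also have "\<dots> = (\<Sum>C\<in>components X E. \<Sum>u\<in>C. h (component_function X E b u))"
    using assms finite_subset by (intro sum_components) auto
  also have "\<dots> = (\<Sum>C\<in>components X E. real (card C) * h (b C))"
    using component_function_eq[OF assms(1)] by (intro sum.cong refl) simp
  finally show ?thesis .
qed

lemma adjacency_form_component_function:
  assumes "symp E" "finite V" "X \<subseteq> V"
  shows "adjacency_form V E (component_function X E b)
    = (\<Sum>C\<in>components X E. real (card (adjacent_pairs C E)) * (b C)\<^sup>2)"
proof -
  let ?g = "\<lambda>(u, v). component_function X E b u * component_function X E b v"
  have "adjacency_form V E (component_function X E b) = (\<Sum>p\<in>adjacent_pairs X E. ?g p)"
    unfolding adjacency_form_def using assms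
    by (intro sum.mono_neutral_right finite_adjacent_pairs)
      (auto simp: adjacent_pairs_def component_function_def split: if_splits)
  also have "\<dots> = (\<Sum>C\<in>components X E. \<Sum>p\<in>adjacent_pairs C E. ?g p)"
    using assms finite_subset by (intro sum_adjacent_pairs_components) auto
  also have "\<dots> = (\<Sum>C\<in>components X E. \<Sum>p\<in>adjacent_pairs C E. (b C)\<^sup>2)"
    using component_function_eq[OF assms(1)]
    by (intro sum.cong refl) (auto simp: adjacent_pairs_def power2_eq_square)
  finally show ?thesis by simp
qed

lemma components_independent:
  assumes "independent_set V E I"
  shows "components I E = (\<lambda>u. {u}) ` I"
proof -
  have "\<not> E a b" if "a \<in> I" "b \<in> I" for a b
    using assms that by (auto simp: independent_set_def)
  then have "x = y" if "(\<lambda>a b. a \<in> I \<and> b \<in> I \<and> E a b)\<^sup>*\<^sup>* x y" for x y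
    using that by (auto elim: rtranclp.cases)
  then have "conn_rel I E = Id_on I"
    unfolding conn_rel_def by auto
  then show ?thesis
    unfolding components_def quotient_def by auto
qed

lemma num_components_independent: "independent_set V E I \<Longrightarrow> num_components I E = card I"
  by (simp add: num_components_eq_card components_independent card_image)

definition component_weight :: "('a \<Rightarrow> 'a \<Rightarrow> bool) \<Rightarrow> real \<Rightarrow> real \<Rightarrow> 'a set \<Rightarrow> real" where
  "component_weight E d \<tau> C
    = (d + \<tau>) * ((real (card C))\<^sup>2 / (real (card (adjacent_pairs C E)) + \<tau> * real (card C)))"

lemma sum_component_weight_le:
  assumes sym: "symp E" and fin: "finite V" and X: "X \<subseteq> V"
    and eigen: "nontrivial_eigenvalues_ge V E d (- \<tau>)" and "\<tau> > 0"
  shows "(\<Sum>C\<in>components X E. component_weight E d \<tau> C) \<le> real (card V)"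
proof -
  let ?Q = "components X E"
  define D where "D C = real (card (adjacent_pairs C E)) + \<tau> * real (card C)" for C
  \<comment> \<open>the values that are optimal in the Cauchy-Schwarz inequality\<close>
  define b where "b C = real (card C) / D C" for C
  define W where "W = (\<Sum>C\<in>?Q. (real (card C))\<^sup>2 / D C)"
  let ?f = "component_function X E b"
  have D: "D C > 0" if "C \<in> ?Q" for C
    using component_card_pos[OF sym finite_subset[OF X fin] that] \<open>\<tau> > 0\<close>
    by (simp add: D_def add_nonneg_pos)
  have sum_f: "(\<Sum>u\<in>V. ?f u) = W"
    using sum_component_function[OF sym fin X, of "\<lambda>x. x" b]
    by (simp add: W_def b_def power2_eq_square)
  have "adjacency_form V E ?f + \<tau> * (\<Sum>u\<in>V. (?f u)\<^sup>2) = (\<Sum>C\<in>?Q. D C * (b C)\<^sup>2)"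
    using sum_component_function[OF sym fin X, of "\<lambda>x. x\<^sup>2" b]
    by (simp add: adjacency_form_component_function[OF sym fin X] D_def sum_distrib_left
      distrib_right mult.assoc flip: sum.distrib)
  also have "\<dots> = W"
    using D unfolding W_def b_def by (intro sum.cong refl) (force simp: power2_eq_square)
  finally have "(d + \<tau>) / real (card V) * W\<^sup>2 \<le> W"
    using eigen[unfolded nontrivial_eigenvalues_ge_def, rule_format, of ?f] sum_f by simp
  moreover have "card V \<noteq> 0" if "W > 0"
    using that sum_f fin by auto
  ultimately have "(d + \<tau>) * W * W \<le> real (card V) * W" if "W > 0"
    using that by (simp add: power2_eq_square field_simps)
  moreover have "W \<ge> 0"
    using D unfolding W_def by (intro sum_nonneg divide_nonneg_pos) auto
  ultimately have "(d + \<tau>) * W \<le> real (card V)"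
    by (cases "W = 0") (auto dest: mult_right_le_imp_le)
  then show ?thesis by (simp add: W_def D_def component_weight_def sum_distrib_left)
qed

definition sparse_component :: "('a \<Rightarrow> 'a \<Rightarrow> bool) \<Rightarrow> real \<Rightarrow> real \<Rightarrow> 'a set \<Rightarrow> bool" where
  "sparse_component E d r C \<longleftrightarrow> real (card (adjacent_pairs C E)) * (real (card C) + r)
    < d * real (card C) * (real (card C) - 1)"

lemma component_weight_gt:
  assumes "\<tau> > 0" "card C > 0" and sparse: "sparse_component E d (d / \<tau>) C"
  shows "real (card C) + d / \<tau> < component_weight E d \<tau> C"
proof -
  define m e where "m = real (card C)" and "e = real (card (adjacent_pairs C E))"
  have "e + \<tau> * m > 0"
    using assms(1,2) by (simp add: m_def e_def add_nonneg_pos)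
  moreover have "(m + d / \<tau>) * (e + \<tau> * m) < (d + \<tau>) * m\<^sup>2"
  proof -
    have "e * (m + d / \<tau>) < d * m * (m - 1)"
      using sparse by (simp add: sparse_component_def m_def e_def)
    moreover have "(m + d / \<tau>) * (\<tau> * m) = \<tau> * m\<^sup>2 + d * m"
      using assms(1) by (simp add: field_simps power2_eq_square)
    ultimately show ?thesis by (simp add: algebra_simps power2_eq_square)
  qed
  ultimately show ?thesis
    by (simp add: component_weight_def pos_less_divide_eq flip: m_def e_def)
qed

locale finite_graph =
  fixes V :: "'a set" and E :: "'a \<Rightarrow> 'a \<Rightarrow> bool"
  assumes finite_vertices: "finite V"
    and symmetric: "symp E"
    and irreflexive: "u \<in> V \<Longrightarrow> \<not> E u u"
begin

lemma component_weight_singleton: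
  assumes "u \<in> V" "\<tau> > 0"
  shows "component_weight E d \<tau> {u} = 1 + d / \<tau>"
proof -
  have "adjacent_pairs {u} E = {}"
    using assms(1) irreflexive by (auto simp: adjacent_pairs_def)
  then show ?thesis using assms(2) by (simp add: component_weight_def field_simps)
qed

lemma component_weight_ge:
  assumes X: "X \<subseteq> V" and "\<tau> > 0" and C: "C \<in> components X E"
    and sparse: "card C \<ge> 2 \<Longrightarrow> sparse_component E d (d / \<tau>) C"
  shows "real (card C) + d / \<tau> \<le> component_weight E d \<tau> C"
proof (cases "card C = 1")
  case True
  then obtain u where u: "C = {u}" by (auto simp: card_1_singleton_iff)
  then have "u \<in> V" using component_subset[OF symmetric C] X by blast
  then show ?thesis using u \<open>\<tau> > 0\<close> by (simp add: component_weight_singleton)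
next
  case False
  have "card C > 0"
    using component_card_pos[OF symmetric finite_subset[OF X finite_vertices] C] .
  with False have "real (card C) + d / \<tau> < component_weight E d \<tau> C"
    using \<open>\<tau> > 0\<close> sparse by (intro component_weight_gt) auto
  then show ?thesis by simp
qed

lemma sum_components_card_add:
  assumes "X \<subseteq> V"
  shows "(\<Sum>C\<in>components X E. real (card C) + r) = real (card X) + r * real (num_components X E)"
  using sum_components[OF symmetric finite_subset[OF assms finite_vertices], of "\<lambda>_. 1::real"]
  by (simp add: sum.distrib num_components_eq_card)

lemma components_count_bound:
  fixes d \<tau> :: real
  assumes X: "X \<subseteq> V" and eigen: "nontrivial_eigenvalues_ge V E d (- \<tau>)" and "\<tau> > 0"
    and sparse: "\<And>C. C \<in> components X E \<Longrightarrow> card C \<ge> 2 \<Longrightarrow> sparse_component E d (d / \<tau>) C"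
  shows "real (card X) + d / \<tau> * real (num_components X E) \<le> real (card V)"
proof -
  have "(\<Sum>C\<in>components X E. real (card C) + d / \<tau>)
      \<le> (\<Sum>C\<in>components X E. component_weight E d \<tau> C)"
    using component_weight_ge[OF X \<open>\<tau> > 0\<close> _ sparse] by (intro sum_mono) blast
  also have "\<dots> \<le> real (card V)"
    by (rule sum_component_weight_le[OF symmetric finite_vertices X eigen \<open>\<tau> > 0\<close>])
  finally show ?thesis by (simp add: sum_components_card_add[OF X])
qed

lemma independent_if_components_singleton:
  assumes X: "X \<subseteq> V" and singleton: "\<And>C. C \<in> components X E \<Longrightarrow> card C = 1"
  shows "independent_set V E X"
  unfolding independent_set_def
proof (intro conjI X ballI notI)
  fix u v assume uv: "u \<in> X" "v \<in> X" "E u v"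
  then have "u \<in> \<Union> (components X E)" by (simp add: Union_components[OF symmetric])
  then obtain C where C: "C \<in> components X E" "u \<in> C" by blast
  moreover have "v \<in> C" using component_closed[OF symmetric C uv(2,3)] .
  ultimately have "u = v" using singleton[OF C(1)] by (auto simp: card_1_singleton_iff)
  then show False using uv irreflexive X by auto
qed

lemma components_count_bound_tight:
  fixes d \<tau> :: real
  assumes X: "X \<subseteq> V" and eigen: "nontrivial_eigenvalues_ge V E d (- \<tau>)" and "\<tau> > 0"
    and sparse: "\<And>C. C \<in> components X E \<Longrightarrow> card C \<ge> 2 \<Longrightarrow> sparse_component E d (d / \<tau>) C"
    and tight: "real (card X) + d / \<tau> * real (num_components X E) = real (card V)"
  shows "independent_set V E X"
proof (rule independent_if_components_singleton[OF X], rule ccontr)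
  let ?Q = "components X E"
  have finX: "finite X" using X finite_vertices finite_subset by blast
  fix C assume C: "C \<in> ?Q" "card C \<noteq> 1"
  have "card C > 0" using component_card_pos[OF symmetric finX C(1)] .
  with C have "real (card C) + d / \<tau> < component_weight E d \<tau> C"
    using \<open>\<tau> > 0\<close> by (intro component_weight_gt sparse) auto
  then have "(\<Sum>C\<in>?Q. real (card C) + d / \<tau>) < (\<Sum>C\<in>?Q. component_weight E d \<tau> C)"
    using C(1) component_weight_ge[OF X \<open>\<tau> > 0\<close> _ sparse] finite_components[OF finX]
    by (intro sum_strict_mono_ex1) auto
  also have "\<dots> \<le> real (card V)"
    by (rule sum_component_weight_le[OF symmetric finite_vertices X eigen \<open>\<tau> > 0\<close>])
  finally show False using tight by (simp add: sum_components_card_add[OF X])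
qed

lemma hoffman_ratio_bound:
  fixes d \<tau> :: real
  assumes "nontrivial_eigenvalues_ge V E d (- \<tau>)" "\<tau> > 0" and I: "independent_set V E I"
  shows "(1 + d / \<tau>) * real (card I) \<le> real (card V)"
proof -
  have "I \<subseteq> V" using I by (simp add: independent_set_def)
  then have "real (card I) + d / \<tau> * real (num_components I E) \<le> real (card V)"
    using assms by (intro components_count_bound) (auto simp: components_independent[OF I])
  then show ?thesis by (simp add: num_components_independent[OF I] distrib_right)
qed

lemma card_Diff_vertices: "S \<subseteq> V \<Longrightarrow> real (card (V - S)) = real (card V) - real (card S)"
  using card_mono[OF finite_vertices, of S]
  by (simp add: card_Diff_subset finite_subset[OF _ finite_vertices] of_nat_diff)

lemma cut_ratio_ge:
  fixes d \<tau> :: real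
  assumes S: "is_vertex_cut V E S"
    and eigen: "nontrivial_eigenvalues_ge V E d (- \<tau>)" and "\<tau> > 0"
    and sparse: "\<And>C. C \<in> components (V - S) E \<Longrightarrow> card C \<ge> 2 \<Longrightarrow> sparse_component E d (d / \<tau>) C"
  shows "d / \<tau> \<le> cut_ratio V E S"
proof -
  have "real (card (V - S)) + d / \<tau> * real (num_components (V - S) E) \<le> real (card V)"
    using Diff_subset eigen \<open>\<tau> > 0\<close> sparse by (rule components_count_bound)
  then show ?thesis
    using S by (simp add: is_vertex_cut_def cut_ratio_def card_Diff_vertices pos_le_divide_eq)
qed

lemma maximum_independent_set_if_cut_ratio_eq:
  fixes d \<tau> :: real
  assumes S: "is_vertex_cut V E S"
    and eigen: "nontrivial_eigenvalues_ge V E d (- \<tau>)" and "\<tau> > 0" "d \<ge> 0"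
    and sparse: "\<And>C. C \<in> components (V - S) E \<Longrightarrow> card C \<ge> 2 \<Longrightarrow> sparse_component E d (d / \<tau>) C"
    and ratio: "cut_ratio V E S = d / \<tau>"
  shows "maximum_independent_set V E (V - S)"
proof -
  have tight: "real (card (V - S)) + d / \<tau> * real (num_components (V - S) E) = real (card V)"
    using S by (simp add: is_vertex_cut_def cut_ratio_def card_Diff_vertices flip: ratio)
  have ind: "independent_set V E (V - S)"
    using Diff_subset eigen \<open>\<tau> > 0\<close> sparse tight by (rule components_count_bound_tight)
  then have "(1 + d / \<tau>) * real (card (V - S)) = real (card V)"
    using tight by (simp add: num_components_independent distrib_right)
  then have "(1 + d / \<tau>) * real (card J) \<le> (1 + d / \<tau>) * real (card (V - S))"
    if "independent_set V E J" for J
    using hoffman_ratio_bound[OF eigen \<open>\<tau> > 0\<close> that] by simp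
  moreover have "1 + d / \<tau> > 0"
    using \<open>\<tau> > 0\<close> \<open>d \<ge> 0\<close> by (simp add: add_pos_nonneg)
  ultimately show ?thesis
    using ind by (simp add: maximum_independent_set_def)
qed

lemma independent_complement_vertex_cut:
  assumes I: "independent_set V E I" "card I \<ge> 2"
  shows "is_vertex_cut V E (V - I)"
    and "cut_ratio V E (V - I) = real (card V) / real (card I) - 1"
proof -
  have "I \<subseteq> V" using I(1) by (simp add: independent_set_def)
  then have comps: "num_components (V - (V - I)) E = card I"
    by (simp add: double_diff num_components_independent[OF I(1)])
  then show "is_vertex_cut V E (V - I)"
    using I(2) by (simp add: is_vertex_cut_def)
  show "cut_ratio V E (V - I) = real (card V) / real (card I) - 1"
    using I(2) \<open>I \<subseteq> V\<close> by (simp add: cut_ratio_def comps card_Diff_vertices field_simps)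
qed

lemma toughness_eqI:
  assumes bound: "\<And>S. is_vertex_cut V E S \<Longrightarrow> r \<le> cut_ratio V E S"
    and S: "is_vertex_cut V E S" "cut_ratio V E S = r"
  shows "toughness V E = r"
proof -
  have "{S. is_vertex_cut V E S} \<subseteq> Pow V"
    by (auto simp: is_vertex_cut_def)
  then have "finite {S. is_vertex_cut V E S}"
    by (rule finite_subset) (simp add: finite_vertices)
  then have "finite {cut_ratio V E S |S. is_vertex_cut V E S}"
    by (rule finite_image_set)
  then have "Min {cut_ratio V E S |S. is_vertex_cut V E S} = r"
    using bound S by (intro Min_eqI) auto
  then show ?thesis by (simp add: toughness_def cut_ratio_def)
qed

end

section \<open>Sparse components from the second eigenvalue\<close>

lemma card_Diff_Id_on:
  assumes "finite C"
  shows "card (C \<times> C - Id_on C) = card C * (card C - 1)"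
proof -
  have "card (Id_on C) = card C"
    by (simp add: Id_on_def card_image inj_on_def UNION_singleton_eq_range)
  then show ?thesis
    using assms by (subst card_Diff_subset)
      (auto simp: card_cartesian_product diff_mult_distrib2 Id_on_def)
qed

text \<open>The product \<open>(N - m) (m + r)\<close> is concave in \<open>m\<close> and invariant under \<open>m \<mapsto> N - r - m\<close>.\<close>

lemma concave_product_ge_end:
  fixes a m r N :: real
  assumes "a \<le> m" "m \<le> N - r - a"
  shows "(N - a) * (a + r) \<le> (N - m) * (m + r)"
proof -
  have "0 \<le> (m - a) * (N - r - a - m)" using assms by simp
  also have "\<dots> = (N - m) * (m + r) - (N - a) * (a + r)" by algebra
  finally show ?thesis by simp
qed

context finite_graph
begin

lemma card_adjacent_pairs_le_eigenvalue:
  fixes d \<theta> :: real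
  assumes C: "C \<subseteq> V" and eigen: "nontrivial_eigenvalues_le V E d \<theta>"
  shows "real (card (adjacent_pairs C E))
    \<le> \<theta> * real (card C) + (d - \<theta>) / real (card V) * (real (card C))\<^sup>2"
proof -
  let ?f = "\<lambda>u. of_bool (u \<in> C) :: real"
  have "V \<inter> C = C" using C by blast
  then have sums: "(\<Sum>u\<in>V. ?f u) = real (card C)" "(\<Sum>u\<in>V. (?f u)\<^sup>2) = real (card C)"
    using finite_vertices by (simp_all add: power2_eq_square flip: of_bool_conj)
  have "adjacency_form V E ?f = (\<Sum>p\<in>adjacent_pairs C E. 1)"
    unfolding adjacency_form_def
    using C by (intro sum.mono_neutral_cong_right finite_adjacent_pairs finite_vertices)
      (auto simp: adjacent_pairs_def)
  then have "adjacency_form V E ?f = real (card (adjacent_pairs C E))" by simp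
  then show ?thesis
    using eigen[unfolded nontrivial_eigenvalues_le_def, rule_format, of ?f] sums by simp
qed

lemma adjacent_pairs_subset_Diff_Id: "C \<subseteq> V \<Longrightarrow> adjacent_pairs C E \<subseteq> C \<times> C - Id_on C"
  using irreflexive by (auto simp: adjacent_pairs_def)

lemma card_adjacent_pairs_le:
  assumes "C \<subseteq> V"
  shows "card (adjacent_pairs C E) \<le> card C * (card C - 1)"
proof -
  have "finite C" using assms finite_vertices finite_subset by blast
  then show ?thesis
    using card_mono[OF _ adjacent_pairs_subset_Diff_Id[OF assms]] by (simp add: card_Diff_Id_on)
qed

lemma card_adjacent_pairs_less:
  assumes "C \<subseteq> V" "u \<in> C" "v \<in> C" "u \<noteq> v" "\<not> E u v"
  shows "card (adjacent_pairs C E) < card C * (card C - 1)"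
proof -
  have "finite C" using assms finite_vertices finite_subset by blast
  moreover have "(u, v) \<in> C \<times> C - Id_on C - adjacent_pairs C E"
    using assms by (auto simp: adjacent_pairs_def)
  then have "adjacent_pairs C E \<subset> C \<times> C - Id_on C"
    using adjacent_pairs_subset_Diff_Id[OF assms(1)] by blast
  ultimately show ?thesis
    using psubset_card_mono by (metis card_Diff_Id_on finite_Diff finite_SigmaI)
qed

lemma sparse_component_if_card_less:
  assumes "C \<subseteq> V" "card C \<ge> 2" "real (card C) + r < d" "r \<ge> 0"
  shows "sparse_component E d r C"
proof -
  define m where "m = real (card C)"
  have m: "m \<ge> 2" using assms(2) by (simp add: m_def)
  have "real (card (adjacent_pairs C E)) \<le> real (card C * (card C - 1))"
    using card_adjacent_pairs_le[OF assms(1)] of_nat_le_iff by blast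
  also have "\<dots> = m * (m - 1)" using assms(2) by (simp add: m_def of_nat_diff)
  finally have "real (card (adjacent_pairs C E)) * (m + r) \<le> m * (m - 1) * (m + r)"
    using m assms(4) by (intro mult_right_mono) auto
  also have "\<dots> < m * (m - 1) * d"
    using m assms(3) by (intro mult_strict_left_mono) (auto simp: m_def)
  finally show ?thesis by (simp add: sparse_component_def m_def mult_ac)
qed

lemma sparse_component_eigenvalue:
  fixes a d r \<theta> :: real
  defines "N \<equiv> real (card V)"
  assumes C: "C \<subseteq> V" "card C > 0"
    and eigen: "nontrivial_eigenvalues_le V E d \<theta>" "\<theta> \<le> d" and "r \<ge> 0"
    and a: "a \<le> real (card C)" "real (card C) \<le> N - r - a"
    and gap: "d * (1 + r) * N < (d - \<theta>) * ((N - a) * (a + r))"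
  shows "sparse_component E d r C"
proof -
  define m e where "m = real (card C)" and "e = real (card (adjacent_pairs C E))"
  have m: "m > 0" using C(2) by (simp add: m_def)
  have "card C \<le> card V" using C(1) finite_vertices by (intro card_mono)
  then have N: "N > 0" using C(2) by (simp add: N_def)
  have "e \<le> \<theta> * m + (d - \<theta>) / N * m\<^sup>2"
    using card_adjacent_pairs_le_eigenvalue[OF C(1) eigen(1)] by (simp add: m_def e_def N_def)
  then have "N * e \<le> N * (\<theta> * m + (d - \<theta>) / N * m\<^sup>2)"
    using N by (intro mult_left_mono) auto
  also have "\<dots> = N * (\<theta> * m) + (d - \<theta>) * m\<^sup>2"
    using N by (simp add: distrib_left)
  finally have "m * ((d - \<theta>) * (N - m)) \<le> N * (d * m - e)"
    by (simp add: algebra_simps power2_eq_square)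
  then have "m * ((d - \<theta>) * (N - m)) * (m + r) \<le> N * (d * m - e) * (m + r)"
    using m \<open>r \<ge> 0\<close> by (intro mult_right_mono) auto
  moreover have "m * (d * (1 + r) * N) < m * ((d - \<theta>) * ((N - m) * (m + r)))"
  proof -
    have "(d - \<theta>) * ((N - a) * (a + r)) \<le> (d - \<theta>) * ((N - m) * (m + r))"
      using a eigen(2) by (intro mult_left_mono concave_product_ge_end) (auto simp: m_def)
    then show ?thesis using gap m by simp
  qed
  ultimately have "N * (m * d * (1 + r)) < N * ((d * m - e) * (m + r))"
    by (simp add: mult_ac)
  then have "m * d * (1 + r) < (d * m - e) * (m + r)"
    using N by simp
  then have "e * (m + r) < d * m * (m - 1)"
    by (simp add: algebra_simps)
  then show ?thesis by (simp add: sparse_component_def m_def e_def)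
qed

end

locale regular_graph = finite_graph +
  fixes d :: nat
  assumes regular: "u \<in> V \<Longrightarrow> card {v \<in> V. E u v} = d"
begin

lemma card_component_le:
  assumes X: "X \<subseteq> V" and two: "num_components X E \<ge> 2" and C: "C \<in> components X E"
  shows "card C + d + 1 \<le> card V"
proof -
  have "\<not> components X E \<subseteq> {C}"
    using two card_mono[of "{C}" "components X E"] by (auto simp: num_components_eq_card)
  then obtain C' where C': "C' \<in> components X E" "C' \<noteq> C" by blast
  obtain w where w: "w \<in> C'" using component_nonempty[OF symmetric C'(1)] by blast
  have "w \<in> X" "C \<subseteq> X"
    using component_subset[OF symmetric C'(1)] component_subset[OF symmetric C] w by auto
  have "w \<notin> C" using components_disjoint[OF symmetric C C'(1)] C'(2) w by blast
  define nbrs where "nbrs = {v \<in> V. E w v}"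
  have fin: "finite nbrs" "finite C"
    using finite_vertices X \<open>C \<subseteq> X\<close> by (auto simp: nbrs_def intro: finite_subset)
  have "w \<notin> nbrs" "card nbrs = d"
    using \<open>w \<in> X\<close> X irreflexive regular by (auto simp: nbrs_def)
  moreover have "C \<inter> insert w nbrs = {}"
  proof -
    have "\<not> E w u" if "u \<in> C" for u
      using component_closed[OF symmetric C that \<open>w \<in> X\<close>] \<open>w \<notin> C\<close> sympD[OF symmetric] by blast
    then show ?thesis using \<open>w \<notin> C\<close> by (auto simp: nbrs_def)
  qed
  ultimately have "card (C \<union> insert w nbrs) = card C + d + 1"
    using fin by (simp add: card_Un_disjoint)
  moreover have "card (C \<union> insert w nbrs) \<le> card V"
    using X \<open>C \<subseteq> X\<close> \<open>w \<in> X\<close> finite_vertices by (intro card_mono) (auto simp: nbrs_def)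
  ultimately show ?thesis by simp
qed

end

section \<open>Sparse components of Kneser graphs\<close>

lemma regular_graph_kneser:
  assumes "k \<ge> 1"
  shows "regular_graph (kneser_verts n k) kneser_adj ((n - k) choose k)"
proof
  show "finite (kneser_verts n k)"
    by (simp add: kneser_verts_eq_nsets finite_imp_finite_nsets)
  show "symp kneser_adj"
    by (auto simp: symp_def kneser_adj_def)
  show "\<not> kneser_adj A A" if "A \<in> kneser_verts n k" for A
    using that assms by (auto simp: kneser_adj_def kneser_verts_def)
  show "card {B \<in> kneser_verts n k. kneser_adj A B} = (n - k) choose k"
    if "A \<in> kneser_verts n k" for A
  proof -
    have A: "A \<subseteq> {1..n}" "card A = k" "finite A"
      using that by (auto simp: kneser_verts_def intro: finite_subset)
    have "{B \<in> kneser_verts n k. kneser_adj A B} = nsets ({1..n} - A) k"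
      by (auto simp: kneser_verts_eq_nsets nsets_def kneser_adj_def)
    then show ?thesis using A by (simp add: card_Diff_subset)
  qed
qed

lemma card_kneser_verts: "card (kneser_verts n k) = n choose k"
  by (simp add: kneser_verts_eq_nsets)

lemma card_kneser_clique:
  assumes C: "C \<subseteq> kneser_verts n k" "pairwise kneser_adj C"
  shows "card C * k \<le> n"
proof -
  have "\<Union> C \<subseteq> {1..n}" using C(1) by (auto simp: kneser_verts_def)
  then have "card (\<Union> C) \<le> n" using card_mono[of "{1..n}"] by simp
  moreover have "card (\<Union> C) = (\<Sum>A\<in>C. card A)"
    using C by (intro card_Union_disjoint)
      (auto simp: kneser_adj_eq_disjnt kneser_verts_def intro: finite_subset)
  moreover have "(\<Sum>A\<in>C. card A) = card C * k"
    using C(1) by (simp add: kneser_verts_def subset_iff)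
  ultimately show ?thesis by simp
qed

lemma binomial_mono_add:
  fixes j k n :: nat
  assumes "j \<le> k" "j + k \<le> n"
  shows "n choose j \<le> n choose k"
proof (cases "2 * k \<le> n")
  case False
  then have "n choose j \<le> n choose (n - k)"
    using assms by (intro binomial_mono) auto
  also have "\<dots> = n choose k"
    using assms by (intro binomial_symmetric[symmetric]) auto
  finally show ?thesis .
qed (use assms in \<open>simp add: binomial_mono\<close>)

lemma kneser_degree_div_least_eigenvalue:
  assumes "k \<ge> 1" "2 * k \<le> n"
  shows "real ((n - k) choose k) / real ((n - k - 1) choose (k - 1)) = real n / real k - 1"
proof -
  have "real k * real ((n - k) choose k) = real (n - k) * real ((n - k - 1) choose (k - 1))"
    using assms times_binomial_minus1_eq[of k "n - k"]
    by (metis less_eq_Suc_le of_nat_mult One_nat_def)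
  moreover have "(n - k - 1) choose (k - 1) > 0" using assms by simp
  ultimately show ?thesis
    using assms by (simp add: field_simps of_nat_diff)
qed

lemma times_binomial_minus2_eq:
  assumes "2 \<le> k" "k \<le> m"
  shows "real k * (real k - 1) * real (m choose k)
    = real m * (real m - 1) * real ((m - 2) choose (k - 2))"
proof -
  have "k * (m choose k) = m * ((m - 1) choose (k - 1))"
    and "(k - 1) * ((m - 1) choose (k - 1)) = (m - 1) * ((m - 2) choose (k - 2))"
    using assms times_binomial_minus1_eq[of k m] times_binomial_minus1_eq[of "k - 1" "m - 1"]
    by (simp_all add: numeral_2_eq_2)
  from this[THEN arg_cong[where f = real]]
  have "real k * real (m choose k) = real m * real ((m - 1) choose (k - 1))"
    and "(real k - 1) * real ((m - 1) choose (k - 1))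
      = (real m - 1) * real ((m - 2) choose (k - 2))"
    using assms by (simp_all add: of_nat_diff)
  then show ?thesis by algebra
qed

lemma binomial_absorb_comp2:
  assumes "k < m" "2 \<le> m"
  shows "(real m - real k) * (real m - real k - 1) * real (m choose k)
    = real m * (real m - 1) * real ((m - 2) choose k)"
proof -
  have "(m - k) * (m choose k) = m * ((m - 1) choose k)"
    and "(m - 1 - k) * ((m - 1) choose k) = (m - 1) * ((m - 2) choose k)"
    using binomial_absorb_comp[of m k] binomial_absorb_comp[of "m - 1" k]
    by (simp_all add: numeral_2_eq_2)
  from this[THEN arg_cong[where f = real]]
  have "(real m - real k) * real (m choose k) = real m * real ((m - 1) choose k)"
    and "(real m - real k - 1) * real ((m - 1) choose k) = (real m - 1) * real ((m - 2) choose k)"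
    using assms by (simp_all add: of_nat_diff diff_diff_eq add.commute)
  then show ?thesis by algebra
qed

lemma kneser_degree_minus_second_eigenvalue:
  assumes "2 \<le> k" "2 * k + 2 \<le> n"
  shows "(real n - 2 * real k) * (real n - 1) / 2
    \<le> real ((n - k) choose k) - real ((n - k - 2) choose (k - 2))"
proof -
  define K x d \<theta> where "K = real k" and "x = real n - real k"
    and "d = real ((n - k) choose k)" and "\<theta> = real ((n - k - 2) choose (k - 2))"
  have x: "x \<ge> K + 2" "K \<ge> 2" and "real (n - k) = x"
    using assms by (simp_all add: x_def K_def of_nat_diff)
  then have \<theta>: "K * (K - 1) * d = x * (x - 1) * \<theta>"
    using times_binomial_minus2_eq[of k "n - k"] assms by (simp add: K_def d_def \<theta>_def)
  have "(n - k) choose 2 \<le> (n - k) choose k"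
    using assms by (intro binomial_mono_add) auto
  moreover have "2 * real ((n - k) choose 2) = x * (x - 1)"
    using times_binomial_minus2_eq[of 2 "n - k"] \<open>real (n - k) = x\<close> assms by simp
  ultimately have "x * (x - 1) / 2 \<le> d" by (simp add: d_def)
  then have "(x * (x - 1) - K * (K - 1)) * (x * (x - 1) / 2) \<le> (x * (x - 1) - K * (K - 1)) * d"
    using x mult_mono[of K x "K - 1" "x - 1"] by (intro mult_left_mono) auto
  also have "\<dots> = x * (x - 1) * (d - \<theta>)"
    using \<theta> by algebra
  finally have "x * (x - 1) * ((x * (x - 1) - K * (K - 1)) / 2) \<le> x * (x - 1) * (d - \<theta>)"
    by (simp add: mult.commute)
  then have "(x * (x - 1) - K * (K - 1)) / 2 \<le> d - \<theta>"
    using x by (simp add: mult_le_cancel_left_pos)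
  moreover have "x * (x - 1) - K * (K - 1) = (real n - 2 * real k) * (real n - 1)"
    unfolding x_def K_def by algebra
  ultimately show ?thesis by (simp add: d_def \<theta>_def)
qed

lemma kneser_vertices_minus_degree:
  assumes "2 \<le> k" "2 * k \<le> n"
  shows "real k * (2 * real n - real k - 1) / (real n * (real n - 1)) * real (n choose k)
    \<le> real (n choose k) - real ((n - k) choose k)"
proof -
  define x N d where "x = real n" and "N = real (n choose k)" and "d = real ((n - k) choose k)"
  have x: "x \<ge> 4" using assms by (simp add: x_def)
  have "(n - k) choose k \<le> (n - 2) choose k"
    using assms by (intro binomial_right_mono) auto
  then have "x * (x - 1) * d \<le> x * (x - 1) * real ((n - 2) choose k)"
    using x by (intro mult_left_mono) (auto simp: d_def)
  also have "\<dots> = (x - real k) * (x - real k - 1) * N"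
    using assms binomial_absorb_comp2[of k n] by (simp add: x_def N_def)
  finally have "real k * (2 * x - real k - 1) * N \<le> x * (x - 1) * (N - d)"
    by (simp add: algebra_simps)
  then show ?thesis
    using x by (simp add: pos_divide_le_eq mult.commute flip: x_def N_def d_def)
qed

lemma kneser_spectral_gap:
  assumes "2 \<le> k" "2 * k + 2 \<le> n"
  shows "real n / real k * real (n choose k)
    \<le> (real ((n - k) choose k) - real ((n - k - 2) choose (k - 2)))
      * (real (n choose k) - real ((n - k) choose k))"
proof -
  define x K N where "x = real n" and "K = real k" and "N = real (n choose k)"
  have x: "K \<ge> 2" "x \<ge> 2 * K + 2" using assms by (auto simp: x_def K_def)
  have poly: "2 * x\<^sup>2 \<le> (x - 2 * K) * K\<^sup>2 * (2 * x - K - 1)"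
  proof -
    obtain u v where "k = 2 + u" and "n = 2 * k + 2 + v"
      using assms le_Suc_ex by metis
    then have "K = 2 + real u" "x = 6 + 2 * real u + real v"
      by (simp_all add: K_def x_def)
    then show ?thesis by (simp add: algebra_simps power2_eq_square)
  qed
  have "x / K * N \<le> (x - 2 * K) * (x - 1) / 2 * (K * (2 * x - K - 1) / (x * (x - 1)) * N)"
  proof -
    have "x / K \<le> (x - 2 * K) * K * (2 * x - K - 1) / (2 * x)"
      using poly x by (simp add: field_simps power2_eq_square)
    also have "\<dots> = (x - 2 * K) * (x - 1) / 2 * (K * (2 * x - K - 1) / (x * (x - 1)))"
      using x by (simp add: field_simps)
    finally have "x / K * N \<le> (x - 2 * K) * (x - 1) / 2 * (K * (2 * x - K - 1) / (x * (x - 1))) * N"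
      by (rule mult_right_mono) (simp add: N_def)
    then show ?thesis by (simp only: mult.assoc)
  qed
  also have "\<dots> \<le> (real ((n - k) choose k) - real ((n - k - 2) choose (k - 2)))
      * (real (n choose k) - real ((n - k) choose k))"
    using kneser_degree_minus_second_eigenvalue[OF assms]
      kneser_vertices_minus_degree[OF assms(1)] assms x
    unfolding x_def K_def N_def by (intro mult_mono' mult_nonneg_nonneg divide_nonneg_nonneg) auto
  finally show ?thesis by (simp add: x_def K_def N_def)
qed

lemma sparse_component_kneser:
  assumes k: "2 \<le> k" "2 * k + 2 \<le> n" and C: "C \<subseteq> kneser_verts n k" "card C \<ge> 2"
    and small: "card C + ((n - k) choose k) + 1 \<le> n choose k"
  shows "sparse_component kneser_adj (real ((n - k) choose k)) (real n / real k - 1) C"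
proof -
  define N d \<theta> r where "N = real (n choose k)" and "d = real ((n - k) choose k)"
    and "\<theta> = real ((n - k - 2) choose (k - 2))" and "r = real n / real k - 1"
  interpret regular_graph "kneser_verts n k" kneser_adj "(n - k) choose k"
    using k by (intro regular_graph_kneser) simp
  have r: "r > 0" using k by (simp add: r_def field_simps)
  have d: "d > 0" using k by (simp add: d_def)
  show ?thesis
    unfolding d_def[symmetric] r_def[symmetric]
  proof (cases "real (card C) + r < d")
    case True
    then show "sparse_component kneser_adj d r C"
      using C r by (intro sparse_component_if_card_less) auto
  next
    case False
    have gap: "(1 + r) * N \<le> (d - \<theta>) * (N - d)"
      using kneser_spectral_gap[OF k] by (simp add: r_def N_def d_def \<theta>_def)
    have "0 < (real n - 2 * real k) * (real n - 1) / 2" using k by simp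
    then have "\<theta> < d"
      using kneser_degree_minus_second_eigenvalue[OF k] unfolding d_def \<theta>_def by linarith
    then have "(d - \<theta>) * (N - d) < (d - \<theta>) * (N - (d - r))"
      using r by (intro mult_strict_left_mono) auto
    with gap have "(1 + r) * N < (d - \<theta>) * (N - (d - r))" by linarith
    then have "d * (1 + r) * N < (d - \<theta>) * ((N - (d - r)) * (d - r + r))"
      using d mult_strict_left_mono[of "(1 + r) * N" _ d] by (simp add: mult_ac)
    moreover have "real (card C) \<le> N - r - (d - r)"
      using small by (simp add: N_def d_def flip: of_nat_add)
    moreover have "nontrivial_eigenvalues_le (kneser_verts n k) kneser_adj d \<theta>"
      using kneser_nontrivial_eigenvalues_le[of k n] k by (simp add: d_def \<theta>_def)
    ultimately show "sparse_component kneser_adj d r C"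
      using False C \<open>\<theta> < d\<close> r
      by (intro sparse_component_eigenvalue[where a = "d - r" and \<theta> = \<theta>])
        (simp_all add: card_kneser_verts flip: N_def)
  qed
qed

subsection \<open>Odd graphs\<close>

text \<open>
  For \<open>n = 2 k + 1\<close> the difference of degree and second eigenvalue is only \<open>2\<close>, so the
  eigenvalue bound helps only from \<open>k + 1\<close> vertices on. The trivial bound covers fewer than \<open>k\<close>
  vertices; a component of \<open>k\<close> vertices is sparse because it is not a clique.
\<close>

lemma regular_graph_odd:
  assumes "k \<ge> 1"
  shows "regular_graph (kneser_verts (2 * k + 1) k) kneser_adj (k + 1)"
  using regular_graph_kneser[OF assms, of "2 * k + 1"] by simp

lemma odd_nontrivial_eigenvalues_le:
  assumes "2 \<le> k"
  shows "nontrivial_eigenvalues_le (kneser_verts (2 * k + 1) k) kneser_adj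
    (real k + 1) (real k - 1)"
proof -
  have "(2 * k + 1 - k) choose k = k + 1" by simp
  moreover have "(2 * k + 1 - k - 2) choose (k - 2) = k - 1"
    using assms binomial_Suc_n[of "k - 2"] by (simp add: numeral_2_eq_2 Suc_diff_Suc)
  ultimately show ?thesis
    using kneser_nontrivial_eigenvalues_le[of k "2 * k + 1"] assms
    by (simp add: of_nat_diff add.commute)
qed

lemma sparse_component_odd_card_eq:
  assumes k: "3 \<le> k" and C: "C \<subseteq> kneser_verts (2 * k + 1) k" "card C = k"
  shows "sparse_component kneser_adj (real k + 1) (1 + 1 / real k) C"
proof -
  interpret regular_graph "kneser_verts (2 * k + 1) k" kneser_adj "k + 1"
    using k by (intro regular_graph_odd) simp
  have "\<not> pairwise kneser_adj C"
  proof
    assume "pairwise kneser_adj C"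
    then have "k * k \<le> 2 * k + 1" using card_kneser_clique C by metis
    moreover have "3 * k \<le> k * k" using k by simp
    ultimately show False using k by linarith
  qed
  then obtain A B where "A \<in> C" "B \<in> C" "A \<noteq> B" "\<not> kneser_adj A B"
    by (auto simp: pairwise_def)
  then have "card (adjacent_pairs C kneser_adj) < k * (k - 1)"
    using card_adjacent_pairs_less C by metis
  then have "real (card (adjacent_pairs C kneser_adj)) + 1 \<le> real (k * (k - 1))"
    by linarith
  then have "real (card (adjacent_pairs C kneser_adj)) * (real k + (1 + 1 / real k))
      \<le> (real k * (real k - 1) - 1) * (real k + (1 + 1 / real k))"
    using k by (intro mult_right_mono) (auto simp: of_nat_diff)
  also have "\<dots> = (real k + 1) * real k * (real k - 1) - 2 - 1 / real k"
    using k by (simp add: field_simps)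
  also have "\<dots> < (real k + 1) * real k * (real k - 1)"
    using divide_nonneg_nonneg[of 1 "real k"] by linarith
  finally show ?thesis by (simp add: sparse_component_def C(2))
qed

lemma sparse_component_odd_small:
  assumes k: "3 \<le> k" and C: "C \<subseteq> kneser_verts (2 * k + 1) k" "2 \<le> card C" "card C \<le> k"
  shows "sparse_component kneser_adj (real k + 1) (1 + 1 / real k) C"
proof (cases "card C = k")
  case True
  then show ?thesis using sparse_component_odd_card_eq k C(1) by blast
next
  case False
  interpret regular_graph "kneser_verts (2 * k + 1) k" kneser_adj "k + 1"
    using k by (intro regular_graph_odd) simp
  have "real (card C) + 1 \<le> real k" using False C(3) by simp
  moreover have "1 / real k < 1" using k by simp
  ultimately have "real (card C) + (1 + 1 / real k) < real k + 1" by linarith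
  then show ?thesis using C by (intro sparse_component_if_card_less) auto
qed

lemma odd_binomial_lower:
  assumes "3 \<le> k"
  shows "real k * (4 * (real k)\<^sup>2 - 1) / 3 \<le> real ((2 * k + 1) choose k)"
proof -
  have "6 * real ((2 * k + 1) choose 3) = (2 * real k + 1) * (2 * real k) * (2 * real k - 1)"
    using times_binomial_minus2_eq[of 3 "2 * k + 1"] assms by (simp add: of_nat_diff)
  then have "real k * (4 * (real k)\<^sup>2 - 1) / 3 = real ((2 * k + 1) choose 3)"
    by (simp add: algebra_simps power2_eq_square)
  also have "\<dots> \<le> real ((2 * k + 1) choose k)"
    using binomial_mono_add[of 3 k "2 * k + 1"] assms by simp
  finally show ?thesis .
qed

lemma odd_spectral_gap:
  assumes "4 \<le> k"
  defines "N \<equiv> real ((2 * k + 1) choose k)"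
  shows "(real k + 1) * (2 + 1 / real k) * N < 2 * ((N - (real k + 1 - 1 / real k)) * (real k + 2))"
proof -
  define K where "K = real k"
  have "2 * (K\<^sup>2 + K - 1) * (K + 2) < (K - 1) * (K * (4 * K\<^sup>2 - 1) / 3)"
  proof -
    obtain u where "k = 4 + u" using assms le_Suc_ex by metis
    then have K: "K = 4 + real u" by (simp add: K_def)
    show ?thesis
      unfolding K by (simp add: field_simps power2_eq_square add_pos_nonneg)
  qed
  also have "\<dots> \<le> (K - 1) * N"
    using odd_binomial_lower[of k] assms(1) unfolding N_def K_def by (intro mult_left_mono) auto
  finally have "(K + 1) * (2 * K + 1) * N < 2 * ((K * N - K\<^sup>2 - K + 1) * (K + 2))"
    by (simp add: algebra_simps power2_eq_square)
  moreover have "K * ((K + 1) * (2 + 1 / K) * N) = (K + 1) * (2 * K + 1) * N"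
    and "K * (2 * ((N - (K + 1 - 1 / K)) * (K + 2))) = 2 * ((K * N - K\<^sup>2 - K + 1) * (K + 2))"
    using assms(1) by (simp_all add: K_def field_simps power2_eq_square)
  ultimately have "K * ((K + 1) * (2 + 1 / K) * N) < K * (2 * ((N - (K + 1 - 1 / K)) * (K + 2)))"
    by (simp only:)
  then show ?thesis
    using assms(1) by (simp add: K_def)
qed

lemma sparse_component_odd_large:
  assumes k: "4 \<le> k" and C: "C \<subseteq> kneser_verts (2 * k + 1) k" "k + 1 \<le> card C"
    and small: "card C + (k + 1) + 1 \<le> (2 * k + 1) choose k"
  shows "sparse_component kneser_adj (real k + 1) (1 + 1 / real k) C"
proof -
  interpret regular_graph "kneser_verts (2 * k + 1) k" kneser_adj "k + 1"
    using k by (intro regular_graph_odd) simp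
  have "real (card C) + (real k + 1) + 1 \<le> real ((2 * k + 1) choose k)"
    using small by linarith
  moreover have "real k + 1 \<le> real (card C) + 1 / real k"
    using C(2) by (simp add: add_increasing2)
  ultimately show ?thesis
    using C odd_spectral_gap[OF k] odd_nontrivial_eigenvalues_le[of k] k
    by (intro sparse_component_eigenvalue[where a = "real k + 1 - 1 / real k" and \<theta> = "real k - 1"])
      (auto simp: card_kneser_verts algebra_simps)
qed

text \<open>
  For components of 30 vertices in \<open>K(7, 3)\<close> the eigenvalue bound alone is too weak, but it gives
  \<open>e \<le> 111\<close> after rounding down.
\<close>

lemma sparse_component_kneser_7_3:
  assumes C: "C \<subseteq> kneser_verts 7 3" "4 \<le> card C" "card C \<le> 30"
  shows "sparse_component kneser_adj 4 (4 / 3) C"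
proof -
  interpret regular_graph "kneser_verts 7 3" kneser_adj 4
    using regular_graph_odd[of 3] by simp
  have eigen: "nontrivial_eigenvalues_le (kneser_verts 7 3) kneser_adj 4 2"
    using odd_nontrivial_eigenvalues_le[of 3] by simp
  have N: "card (kneser_verts 7 3) = 35"
    by (simp add: card_kneser_verts eval_nat_numeral)
  show ?thesis
  proof (cases "card C = 30")
    case True
    have "real (card (adjacent_pairs C kneser_adj)) < 112"
      using card_adjacent_pairs_le_eigenvalue[OF C(1) eigen] by (simp add: N True)
    then have "card (adjacent_pairs C kneser_adj) \<le> 111" by simp
    then show ?thesis by (simp add: sparse_component_def True)
  next
    case False
    then have "real (card C) \<le> 29" using C(3) by simp
    then show ?thesis
      using C by (intro sparse_component_eigenvalue[OF _ _ eigen, where a = 4]) (auto simp: N)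
  qed
qed

lemma sparse_component_odd:
  assumes k: "3 \<le> k" and C: "C \<subseteq> kneser_verts (2 * k + 1) k" "2 \<le> card C"
    and small: "card C + (k + 1) + 1 \<le> (2 * k + 1) choose k"
  shows "sparse_component kneser_adj (real k + 1) (1 + 1 / real k) C"
proof -
  consider "card C \<le> k" | "4 \<le> k" "k + 1 \<le> card C" | "k = 3" "4 \<le> card C"
    using k by force
  then show ?thesis
  proof cases
    case 1
    then show ?thesis by (rule sparse_component_odd_small[OF k C])
  next
    case 2
    then show ?thesis using sparse_component_odd_large C(1) small by blast
  next
    case 3
    then have "card C \<le> 30" using small by (simp add: eval_nat_numeral)
    then show ?thesis using sparse_component_kneser_7_3[of C] C 3 by simp
  qed
qed

section \<open>Toughness\<close>

lemma kneser_cut_sparse_component: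
  assumes k: "2 \<le> k" "2 * k + 1 \<le> n" "\<not> (k = 2 \<and> n = 5)"
    and S: "is_vertex_cut (kneser_verts n k) kneser_adj S"
    and C: "C \<in> components (kneser_verts n k - S) kneser_adj" "card C \<ge> 2"
  shows "sparse_component kneser_adj (real ((n - k) choose k)) (real n / real k - 1) C"
proof -
  interpret regular_graph "kneser_verts n k" kneser_adj "(n - k) choose k"
    using k by (intro regular_graph_kneser) simp
  have sub: "C \<subseteq> kneser_verts n k"
    using component_subset[OF symmetric C(1)] by blast
  have small: "card C + ((n - k) choose k) + 1 \<le> n choose k"
    using card_component_le[OF Diff_subset _ C(1)] S
    by (simp add: is_vertex_cut_def card_kneser_verts)
  show ?thesis
  proof (cases "n = 2 * k + 1")
    case True
    then have "3 \<le> k" using k by (cases "k = 2") auto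
    moreover have "real n / real k - 1 = 1 + 1 / real k"
      using True k by (simp add: field_simps)
    moreover have "(n - k) choose k = k + 1" using True by simp
    ultimately show ?thesis
      using sparse_component_odd[of k C] sub C(2) small True by (simp add: algebra_simps)
  next
    case False
    then show ?thesis
      using sparse_component_kneser[OF k(1) _ sub C(2) small] k(2) by simp
  qed
qed

lemma kneser_cut_ratio:
  assumes k: "2 \<le> k" "2 * k + 1 \<le> n" "\<not> (k = 2 \<and> n = 5)"
    and S: "is_vertex_cut (kneser_verts n k) kneser_adj S"
  shows "real n / real k - 1 \<le> cut_ratio (kneser_verts n k) kneser_adj S"
    and "cut_ratio (kneser_verts n k) kneser_adj S = real n / real k - 1 \<Longrightarrow>
      maximum_independent_set (kneser_verts n k) kneser_adj (kneser_verts n k - S)"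
proof -
  interpret regular_graph "kneser_verts n k" kneser_adj "(n - k) choose k"
    using k by (intro regular_graph_kneser) simp
  define \<tau> where "\<tau> = real ((n - k - 1) choose (k - 1))"
  have \<tau>: "\<tau> > 0" and ratio: "real ((n - k) choose k) / \<tau> = real n / real k - 1"
    using k kneser_degree_div_least_eigenvalue[of k n] by (simp_all add: \<tau>_def)
  have eigen: "nontrivial_eigenvalues_ge (kneser_verts n k) kneser_adj
      (real ((n - k) choose k)) (- \<tau>)"
    using k unfolding \<tau>_def by (intro kneser_nontrivial_eigenvalues_ge) simp
  note sparse = kneser_cut_sparse_component[OF k S, folded ratio]
  show "real n / real k - 1 \<le> cut_ratio (kneser_verts n k) kneser_adj S"
    using cut_ratio_ge[OF S eigen \<tau> sparse] unfolding ratio .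
  assume "cut_ratio (kneser_verts n k) kneser_adj S = real n / real k - 1"
  then show "maximum_independent_set (kneser_verts n k) kneser_adj (kneser_verts n k - S)"
    using maximum_independent_set_if_cut_ratio_eq[OF S eigen \<tau> _ sparse] unfolding ratio by simp
qed

lemma kneser_star_vertex_cut:
  assumes k: "2 \<le> k" "2 * k \<le> n"
  defines "S \<equiv> kneser_verts n k - {A \<in> kneser_verts n k. 1 \<in> A}"
  shows "is_vertex_cut (kneser_verts n k) kneser_adj S"
    and "cut_ratio (kneser_verts n k) kneser_adj S = real n / real k - 1"
proof -
  interpret regular_graph "kneser_verts n k" kneser_adj "(n - k) choose k"
    using k by (intro regular_graph_kneser) simp
  define star where "star = {A \<in> kneser_verts n k. 1 \<in> A}"
  have "star = {T \<in> nsets {1..n} k. {1} \<subseteq> T}" by (simp add: star_def kneser_verts_eq_nsets)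
  then have card_star: "card star = (n - 1) choose (k - 1)"
    using card_supersets_within[of "{1..n}" "{1}" k] k by simp
  moreover have "n - 1 \<le> (n - 1) choose (k - 1)"
    using k by (intro upper_le_binomial) auto
  ultimately have "card star \<ge> 2" using k by linarith
  moreover have "independent_set (kneser_verts n k) kneser_adj star"
    by (auto simp: independent_set_def kneser_adj_def star_def)
  ultimately have cut: "is_vertex_cut (kneser_verts n k) kneser_adj S"
    "cut_ratio (kneser_verts n k) kneser_adj S = real (n choose k) / real (card star) - 1"
    using independent_complement_vertex_cut[of star]
    by (simp_all add: S_def star_def card_kneser_verts)
  show "is_vertex_cut (kneser_verts n k) kneser_adj S" by (rule cut(1))
  have "k * (n choose k) = n * card star"
    using times_binomial_minus1_eq[of k n] card_star k by simp
  then have "real k * real (n choose k) = real n * real (card star)"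
    by (metis of_nat_mult)
  then show "cut_ratio (kneser_verts n k) kneser_adj S = real n / real k - 1"
    unfolding cut(2) using k \<open>card star \<ge> 2\<close> by (simp add: field_simps)
qed

theorem toughness_kneser:
  assumes k: "2 \<le> k" "2 * k + 1 \<le> n" "\<not> (k = 2 \<and> n = 5)"
  shows "toughness (kneser_verts n k) kneser_adj = real n / real k - 1"
proof -
  interpret regular_graph "kneser_verts n k" kneser_adj "(n - k) choose k"
    using k by (intro regular_graph_kneser) simp
  show ?thesis
    using toughness_eqI kneser_cut_ratio(1)[OF k] kneser_star_vertex_cut[of k n] k by simp
qed

theorem kneser_toughness_attained:
  assumes k: "2 \<le> k" "2 * k + 1 \<le> n" "\<not> (k = 2 \<and> n = 5)"
    and S: "is_vertex_cut (kneser_verts n k) kneser_adj S"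
    and "toughness (kneser_verts n k) kneser_adj = cut_ratio (kneser_verts n k) kneser_adj S"
  shows "maximum_independent_set (kneser_verts n k) kneser_adj (kneser_verts n k - S)"
  using kneser_cut_ratio(2)[OF k S] assms(5) by (simp add: toughness_kneser[OF k])

theorem theorem1p2:
  fixes n k :: nat
  assumes "k \<in> {3, 4}" and "n \<ge> 2 * k + 1"
  shows "toughness (kneser_verts n k) kneser_adj = real n / real k - 1
         \<and> (\<forall>S. is_vertex_cut (kneser_verts n k) kneser_adj S \<and>
               toughness (kneser_verts n k) kneser_adj =
                 real (card S) / real (num_components (kneser_verts n k - S) kneser_adj)
             \<longrightarrow> (\<exists>I. maximum_independent_set (kneser_verts n k) kneser_adj I \<and>
                      S = kneser_verts n k - I))"
proof (intro conjI allI impI)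
  have k: "2 \<le> k" "2 * k + 1 \<le> n" "\<not> (k = 2 \<and> n = 5)" using assms by auto
  then show "toughness (kneser_verts n k) kneser_adj = real n / real k - 1"
    by (rule toughness_kneser)
  fix S
  assume S: "is_vertex_cut (kneser_verts n k) kneser_adj S \<and>
    toughness (kneser_verts n k) kneser_adj =
      real (card S) / real (num_components (kneser_verts n k - S) kneser_adj)"
  then have "maximum_independent_set (kneser_verts n k) kneser_adj (kneser_verts n k - S)"
    by (intro kneser_toughness_attained[OF k]) (simp_all add: cut_ratio_def)
  moreover have "S = kneser_verts n k - (kneser_verts n k - S)"
    using S by (auto simp: is_vertex_cut_def)
  ultimately show "\<exists>I. maximum_independent_set (kneser_verts n k) kneser_adj I
      \<and> S = kneser_verts n k - I"
    by blast
qed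

end
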